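(* For any $L\ge M\ge 0$, $\lambda\in\mathrm{Sign}_L^+$, $\mu\in\mathrm{Sign}_M^+$, the function $F_{\lambda/\mu}(u_1,\dots,u_{L-M})$ is symmetric with respect to permutations of the variables $u_1,\dots,u_{L-M}$. For any $L,k\ge0$ and $\lambda,\nu\in\mathrm{Sign}_L$, the function $G_{\lambda/\nu}(u_1,\dots,u_k)$ is symmetric with respect to permutations of the variables $u_1,\dots,u_k$.
   Context: Throughout, $q,s$ are fixed generic complex parameters. Signatures: a signature of length $L$ is a string of integers $\lambda=(\lambda_1\ge\dots\ge\lambda_L)$; $\mathrm{Sign}_L$ is the set of all of them, $\mathrm{Sign}_L^+$ those with nonnegative entries; $\mathrm{Sign}_0=\mathrm{Sign}_0^+=\{\varnothing\}$. Vertex weights: for $u\in\mathbb{C}$ and integers $m\ge 0$, $w_u(m,0;m,0)=\frac{1-sq^mu}{1-su}$, $w_u(m,1;m,1)=\frac{u-sq^m}{1-su}$, $w_u(m+1,0;m,1)=\frac{(1-s^2q^m)u}{1-su}$, $w_u(m,1;m+1,0)=\frac{1-q^{m+1}}{1-su}$, and $w_u(i_1,j_1;i_2,j_2)=0$ for all other nonnegative integers. Path weights: in the square grid, assign to each vertex $(i,j)$ the variable $u_j$ (constant along rows). A vertex is interior to an up-right path if it lies on the path and is not its beginning or ending vertex. The weight of a finite collection of up-right paths is the product, over all vertices interior to the paths of the collection, of $w_{u_j}(i_1,j_1;i_2,j_2)$, where $i_1,j_1,i_2,j_2$ are the numbers of paths of the collection containing the South, West, North, East edge at the vertex (weight $1$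 if there are no interior vertices). Two collections are identified if they have the same interior vertices and the same numbers $(i_1,j_1,i_2,j_2)$ at each of them. $F$: for $L\ge M\ge0$, $\lambda\in\mathrm{Sign}^+_L$, $\mu\in\mathrm{Sign}^+_M$, the rational function $F_{\lambda/\mu}(u_1,\dots,u_{L-M})$ is the sum of weights of all collections of $L$ up-right paths that start with the vertical edges $(\mu_m,0)\to(\mu_m,1)$, $1\le m\le M$, and the horizontal edges $(-1,j)\to(0,j)$, $1\le j\le L-M$, and end with the vertical edges $(\lambda_l,L-M)\to(\lambda_l,L-M+1)$, $1\le l\le L$. $G$: for $L,k\ge0$, $\lambda,\nu\in\mathrm{Sign}_L$, the rational function $G_{\lambda/\nu}(u_1,\dots,u_k)$ is the sum of weights of all collections of $L$ up-right paths that start with the vertical edges $(\nu_n,0)\to(\nu_n,1)$, $1\le n\le L$, and end with the vertical edges $(\lambda_l,k)\to(\lambda_l,k+1)$, $1\le l\le L$. *)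

theory Defs
  imports Complex_Main "HOL-Library.Multiset" "HOL-Combinatorics.Permutations"
begin

definition Sign :: "nat \<Rightarrow> int list set" where
  "Sign L = {lam. length lam = L \<and> sorted_wrt (\<ge>) lam}"

definition Sign_plus :: "nat \<Rightarrow> int list set" where
  "Sign_plus L = {lam \<in> Sign L. \<forall>x\<in>set lam. 0 \<le> x}"

text \<open>The weight is meaningful for \<open>s * u \<noteq> 1\<close> only; at the pole, division by zero
  makes it \<open>0\<close>, so statements about it must assume \<open>s * u \<noteq> 1\<close>.\<close>

fun vertex_weight :: "complex \<Rightarrow> complex \<Rightarrow> complex \<Rightarrow> nat \<times> nat \<times> nat \<times> nat \<Rightarrow> complex" where
  "vertex_weight q s u (i1, j1, i2, j2) =
    (if j1 = 0 \<and> j2 = 0 \<and> i2 = i1 then (1 - s * q ^ i1 * u) / (1 - s * u)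
     else if j1 = 1 \<and> j2 = 1 \<and> i2 = i1 then (u - s * q ^ i1) / (1 - s * u)
     else if j1 = 0 \<and> j2 = 1 \<and> i1 = i2 + 1 then (1 - s^2 * q ^ i2) * u / (1 - s * u)
     else if j1 = 1 \<and> j2 = 0 \<and> i2 = i1 + 1 then (1 - q ^ (i1 + 1)) / (1 - s * u)
     else 0)"

type_synonym vertex = "int \<times> int"
type_synonym edge = "vertex \<times> vertex"

definition up_right_step :: "vertex \<Rightarrow> vertex \<Rightarrow> bool" where
  "up_right_step v w \<longleftrightarrow>
     w = (fst v + 1, snd v) \<or> w = (fst v, snd v + 1)"

text \<open>A path is the list of the vertices it visits; it has at least one edge, since all paths
  considered below begin and end with prescribed edges.\<close>

definition up_right_path :: "vertex list \<Rightarrow> bool" where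
  "up_right_path p \<longleftrightarrow> 2 \<le> length p \<and> successively up_right_step p"

definition path_edges :: "vertex list \<Rightarrow> edge list" where
  "path_edges p = zip p (tl p)"

text \<open>A collection is a multiset of paths: it is unordered, repetitions are allowed, and nothing
  prescribes which starting edge is joined to which ending edge.\<close>

definition path_collections :: "edge multiset \<Rightarrow> edge multiset \<Rightarrow> vertex list multiset set" where
  "path_collections S E =
     {C. (\<forall>p\<in>#C. up_right_path p) \<and>
         image_mset (\<lambda>p. hd (path_edges p)) C = S \<and>
         image_mset (\<lambda>p. last (path_edges p)) C = E}"

definition interior_vertices :: "vertex list multiset \<Rightarrow> vertex set" where
  "interior_vertices C = (\<Union>p\<in>set_mset C. set p - {hd p, last p})"

definition edge_count :: "vertex list multiset \<Rightarrow> edge \<Rightarrow> nat" where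
  "edge_count C e = size {#p \<in># C. e \<in> set (path_edges p)#}"

text \<open>The numbers of paths through the South, West, North and East edges, in this order.\<close>

definition edge_numbers :: "vertex list multiset \<Rightarrow> vertex \<Rightarrow> nat \<times> nat \<times> nat \<times> nat" where
  "edge_numbers C v = (case v of (i, j) \<Rightarrow>
     (edge_count C ((i, j - 1), (i, j)), edge_count C ((i - 1, j), (i, j)),
      edge_count C ((i, j), (i, j + 1)), edge_count C ((i, j), (i + 1, j))))"

text \<open>Two collections are identified iff they have the same configuration, i.e. the same interior
  vertices with the same edge numbers there.\<close>

definition configuration ::
    "vertex list multiset \<Rightarrow> (vertex \<rightharpoonup> nat \<times> nat \<times> nat \<times> nat)" where
  "configuration C = (\<lambda>v. if v \<in> interior_vertices C then Some (edge_numbers C v) else None)"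

definition configuration_weight ::
    "complex \<Rightarrow> complex \<Rightarrow> (nat \<Rightarrow> complex) \<Rightarrow> (vertex \<rightharpoonup> nat \<times> nat \<times> nat \<times> nat) \<Rightarrow> complex" where
  "configuration_weight q s u c =
     (\<Prod>v\<in>dom c. vertex_weight q s (u (nat (snd v))) (the (c v)))"

definition path_sum ::
    "complex \<Rightarrow> complex \<Rightarrow> edge multiset \<Rightarrow> edge multiset \<Rightarrow> (nat \<Rightarrow> complex) \<Rightarrow> complex" where
  "path_sum q s S E u = (\<Sum>c \<in> configuration ` path_collections S E. configuration_weight q s u c)"

definition vertical_edges :: "int list \<Rightarrow> int \<Rightarrow> edge multiset" where
  "vertical_edges lam j = {#((x, j), (x, j + 1)). x \<in># mset lam#}"

definition left_edges :: "nat \<Rightarrow> edge multiset" where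
  "left_edges n = {#((-1, int j), (0, int j)). j \<in># mset_set {1..n}#}"

text \<open>Variables are given as \<open>u :: nat \<Rightarrow> complex\<close>, of which only the values at
  \<open>1, \<dots>, n\<close> matter, with \<open>n = L - M\<close> for \<open>F\<close> and \<open>n = k\<close> for \<open>G\<close>.\<close>

definition F :: "complex \<Rightarrow> complex \<Rightarrow> int list \<Rightarrow> int list \<Rightarrow> (nat \<Rightarrow> complex) \<Rightarrow> complex" where
  "F q s lam mu u = (let n = length lam - length mu in
     path_sum q s (vertical_edges mu 0 + left_edges n) (vertical_edges lam (int n)) u)"

definition G :: "complex \<Rightarrow> complex \<Rightarrow> nat \<Rightarrow> int list \<Rightarrow> int list \<Rightarrow> (nat \<Rightarrow> complex) \<Rightarrow> complex" where
  "G q s k lam nu u = path_sum q s (vertical_edges nu 0) (vertical_edges lam (int k)) u"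

text \<open>There are finitely many collections with given starting and ending edges, so the sum in
  \<open>path_sum\<close> is a genuine finite sum.\<close>

lemma up_right_path_bounds:
  assumes "successively up_right_step p" "p \<noteq> []"
  shows "set p \<subseteq> {fst (hd p)..fst (last p)} \<times> {snd (hd p)..snd (last p)} \<and>
    int (length p) = fst (last p) + snd (last p) - fst (hd p) - snd (hd p) + 1"
  using assms
proof (induction p rule: induct_list012)
  case (3 x y zs)
  have step: "up_right_step x y" and "successively up_right_step (y # zs)"
    using "3.prems" by auto
  with "3.IH"(2) have IH: "set (y # zs) \<subseteq>
        {fst y..fst (last (y # zs))} \<times> {snd y..snd (last (y # zs))}"
      "int (length (y # zs)) = fst (last (y # zs)) + snd (last (y # zs)) - fst y - snd y + 1"
    by auto
  define l where "l = last (y # zs)"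
  have l: "last (x # y # zs) = l" by (simp add: l_def)
  have "y \<in> {fst y..fst l} \<times> {snd y..snd l}" using IH(1) unfolding l_def by auto
  hence "{fst y..fst l} \<times> {snd y..snd l} \<subseteq> {fst x..fst l} \<times> {snd x..snd l}"
    "x \<in> {fst x..fst l} \<times> {snd x..snd l}"
    using step by (cases x; cases y; auto simp: up_right_step_def)+
  moreover have "int (length (x # y # zs)) = fst l + snd l - fst x - snd x + 1"
    using IH(2) step unfolding l_def[symmetric] by (auto simp: up_right_step_def)
  ultimately show ?case
    using IH(1) unfolding l l_def[symmetric] by auto
qed auto

lemma finite_path_collections: "finite (path_collections S E)"
proof -
  define V where "V = (\<lambda>a b. {fst a..fst b} \<times> {snd a..snd b} :: vertex set)"
  define P where "P = (\<Union>e\<in>set_mset S. \<Union>f\<in>set_mset E. \<Union>v\<in>{fst e}. \<Union>w\<in>{snd f}.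
    {p. set p \<subseteq> V v w \<and> length p = nat (fst w + snd w - fst v - snd v + 1)})"
  have "finite P"
    unfolding P_def V_def by (intro finite_UN_I finite_lists_length_eq) auto
  have "C \<in> mset ` {ps. set ps \<subseteq> P \<and> length ps = size S}" if C: "C \<in> path_collections S E" for C
  proof -
    have "p \<in> P" if "p \<in># C" for p
    proof -
      have p: "up_right_path p" using C that by (auto simp: path_collections_def)
      hence len: "2 \<le> length p" and suc: "successively up_right_step p"
        by (auto simp: up_right_path_def)
      have "hd (path_edges p) \<in># S" "last (path_edges p) \<in># E"
        using C that by (auto simp: path_collections_def)
      moreover have "fst (hd (path_edges p)) = hd p"
        using len by (cases p; cases "tl p") (auto simp: path_edges_def)
      moreover have "snd (last (path_edges p)) = last p"
        using len by (cases p) (auto simp: path_edges_def last_conv_nth nth_tl)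
      moreover have "p \<noteq> []" using len by auto
      ultimately show ?thesis
        using up_right_path_bounds[OF suc] unfolding P_def V_def by fastforce
    qed
    moreover have "size C = size S" using C by (auto simp: path_collections_def)
    moreover obtain ps where "C = mset ps" using ex_mset by metis
    ultimately show ?thesis by auto
  qed
  moreover have "finite (mset ` {ps. set ps \<subseteq> P \<and> length ps = size S})"
    using \<open>finite P\<close> by (intro finite_imageI finite_lists_length_eq)
  ultimately show ?thesis by (meson finite_subset subsetI)
qed

end

theory Submission
  imports Defs
begin

text \<open>A collection of paths enters \<open>path_sum\<close> only through the multiset of its edges, and the edge
  multisets that occur are exactly those with conservation at every interior vertex. Since the vertex
  weight vanishes whenever conservation fails, the path sum is therefore the partition function of the
  vertex model on a finite box: a sum of products of vertex weights over unconstrained edge numbers.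
  It suffices to exchange the variables of two adjacent rows. Fix all edge numbers
  except on the edges inside these two rows; the remaining sum is computed column by column, and by
  the Yang--Baxter equation an R-matrix can be moved through the columns from left to right. Both rows have
  the same number of paths (none or one) entering at the left and none leaving at the right, and on
  such boundary states the R-matrix acts by the same scalar. Dividing by it gives the symmetry, by
  continuity also where it vanishes.\<close>

subsection \<open>The Yang--Baxter equation\<close>

declare vertex_weight.simps [simp del]

text \<open>The weight with its denominator \<open>1 - s * u\<close> cleared: a polynomial in
  \<open>u\<close>, so that the Yang--Baxter equation becomes a family of polynomial
  identities.\<close>

fun vertex_numerator :: "complex \<Rightarrow> complex \<Rightarrow> complex \<Rightarrow> nat \<times> nat \<times> nat \<times> nat \<Rightarrow> complex" where
  "vertex_numerator q s u (i1, j1, i2, j2) =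
    (if j1 = 0 \<and> j2 = 0 \<and> i2 = i1 then 1 - s * q ^ i1 * u
     else if j1 = 1 \<and> j2 = 1 \<and> i2 = i1 then u - s * q ^ i1
     else if j1 = 0 \<and> j2 = 1 \<and> i1 = i2 + 1 then (1 - s^2 * q ^ i2) * u
     else if j1 = 1 \<and> j2 = 0 \<and> i2 = i1 + 1 then 1 - q ^ (i1 + 1)
     else 0)"

lemma vertex_weight_numerator: "vertex_weight q s u x = vertex_numerator q s u x / (1 - s * u)"
  by (cases x) (auto simp: vertex_weight.simps)

declare vertex_numerator.simps [simp del]

lemma vertex_weight_nonzero:
  assumes "vertex_weight q s u (i1, j1, i2, j2) \<noteq> 0"
  shows "i1 + j1 = i2 + j2" "j1 \<le> 1" "j2 \<le> 1"
  using assms by (auto simp: vertex_weight.simps split: if_splits)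

lemma vertex_weight_eq_0: "i1 + j1 \<noteq> i2 + j2 \<Longrightarrow> vertex_weight q s u (i1, j1, i2, j2) = 0"
  using vertex_weight_nonzero(1) by blast

lemma atMost_one: "{..1::nat} = {0, 1}"
  by auto

text \<open>Two stacked vertices, \<open>u\<close> belonging to the lower one, summed over the edge
  between them. Conservation gives \<open>k \<le> \<alpha> + h\<close>, so the range of
  \<open>k\<close> is complete for \<open>h \<le> 1\<close>.\<close>

definition column_weight ::
    "complex \<Rightarrow> complex \<Rightarrow> complex \<Rightarrow> complex \<Rightarrow> nat \<Rightarrow> nat \<Rightarrow> nat \<Rightarrow> nat \<Rightarrow> nat \<Rightarrow> nat \<Rightarrow> complex" where
  "column_weight q s u v \<alpha> h g \<beta> h' g' =
     (\<Sum>k\<le>\<alpha> + 1. vertex_weight q s u (\<alpha>, h, k, h') * vertex_weight q s v (k, g, \<beta>, g'))"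

text \<open>The six-vertex R-matrix, normalised to be polynomial; the first component of each pair of
  horizontal edges belongs to the row with variable \<open>u\<close>.\<close>

fun R_weight :: "complex \<Rightarrow> complex \<Rightarrow> complex \<Rightarrow> nat \<Rightarrow> nat \<Rightarrow> nat \<Rightarrow> nat \<Rightarrow> complex" where
  "R_weight q u v h g h' g' =
    (if h = g \<and> h' = h \<and> g' = g then v - q * u
     else if h + g = 1 \<and> h' + g' = 1 then
       (if h = 1 then (if h' = 1 then (1 - q) * v else q * (v - u))
        else (if h' = 1 then v - u else (1 - q) * u))
     else 0)"

declare R_weight.simps [simp del]

text \<open>Conservation at the lower vertex leaves only \<open>k = \<alpha> + h - h'\<close>. The
  guard excludes the case in which this subtraction of natural numbers would truncate.\<close>

definition column_numerator ::
    "complex \<Rightarrow> complex \<Rightarrow> complex \<Rightarrow> complex \<Rightarrow> nat \<Rightarrow> nat \<Rightarrow> nat \<Rightarrow> nat \<Rightarrow> nat \<Rightarrow> nat \<Rightarrow> complex" where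
  "column_numerator q s u v \<alpha> h g \<beta> h' g' =
     (if h' \<le> \<alpha> + h
      then vertex_numerator q s u (\<alpha>, h, \<alpha> + h - h', h') * vertex_numerator q s v (\<alpha> + h - h', g, \<beta>, g')
      else 0)"

lemma column_weight_numerator:
  assumes "h \<le> 1"
  shows "column_weight q s u v \<alpha> h g \<beta> h' g' =
     column_numerator q s u v \<alpha> h g \<beta> h' g' / ((1 - s * u) * (1 - s * v))"
proof (cases "h' \<le> \<alpha> + h")
  case True
  have "column_weight q s u v \<alpha> h g \<beta> h' g' = (\<Sum>k\<in>{\<alpha> + h - h'}.
      vertex_weight q s u (\<alpha>, h, k, h') * vertex_weight q s v (k, g, \<beta>, g'))"
    unfolding column_weight_def
    using assms True by (intro sum.mono_neutral_right ballI) (auto simp: vertex_weight_eq_0)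
  with True show ?thesis by (simp add: vertex_weight_numerator column_numerator_def)
next
  case False
  then show ?thesis unfolding column_weight_def
    by (auto intro!: sum.neutral simp: vertex_weight_eq_0 column_numerator_def)
qed

lemma column_weight_nonzero:
  assumes "column_weight q s u v \<alpha> h g \<beta> h' g' \<noteq> 0"
  shows "\<alpha> + h + g = \<beta> + h' + g'"
proof -
  obtain k where "vertex_weight q s u (\<alpha>, h, k, h') \<noteq> 0" "vertex_weight q s v (k, g, \<beta>, g') \<noteq> 0"
    using assms unfolding column_weight_def by (metis (no_types, lifting) mult_eq_0_iff sum.neutral)
  then show ?thesis by (auto dest!: vertex_weight_nonzero(1))
qed

lemma R_weight_nonzero:
  assumes "R_weight q u v h g h' g' \<noteq> 0"
  shows "h + g = h' + g'"
  using assms by (auto simp: R_weight.simps split: if_splits)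

text \<open>A finite check: the horizontal edges give sixteen boundary states and conservation
  determines \<open>\<beta>\<close>. What remains are polynomial identities in \<open>q\<close>,
  \<open>s\<close>, \<open>u\<close>, \<open>v\<close> and a power of \<open>q\<close>.\<close>

lemma yang_baxter_numerator:
  assumes "h \<le> 1" "g \<le> 1" "h'' \<le> 1" "g'' \<le> 1" "\<alpha> + h + g = \<beta> + h'' + g''"
  shows "(\<Sum>h'\<le>1. \<Sum>g'\<le>1. column_numerator q s u v \<alpha> h g \<beta> h' g' * R_weight q u v h' g' h'' g'') =
         (\<Sum>h'\<le>1. \<Sum>g'\<le>1. R_weight q u v h g h' g' * column_numerator q s v u \<alpha> h' g' \<beta> h'' g'')"
proof -
  have \<beta>: "\<beta> = \<alpha> + h + g - h'' - g''" and le: "h'' + g'' \<le> \<alpha> + h + g" using assms by auto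
  have "h = 0 \<or> h = 1" "g = 0 \<or> g = 1" "h'' = 0 \<or> h'' = 1" "g'' = 0 \<or> g'' = 1"
    using assms by auto
  \<comment> \<open>For \<open>\<alpha> \<ge> 2\<close> every subtraction of edge numbers is exact.
    The two small values are separated because some states cannot occur there.\<close>
  moreover have "\<alpha> = 0 \<or> \<alpha> = 1 \<or> (\<exists>m. \<alpha> = Suc (Suc m))"
    by (metis One_nat_def not0_implies_Suc)
  ultimately show ?thesis
    using le unfolding \<beta> atMost_one
    by (elim disjE exE)
      (simp_all add: column_numerator_def R_weight.simps vertex_numerator.simps,
       simp_all add: algebra_simps power2_eq_square)
qed

text \<open>Columns and R-matrix both conserve paths, so without global conservation every term
  vanishes. Otherwise both sides have the denominator \<open>(1 - s * u) * (1 - s * v)\<close>,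
  which is symmetric in \<open>u\<close> and \<open>v\<close>.\<close>

lemma yang_baxter:
  assumes "h \<le> 1" "g \<le> 1" "h'' \<le> 1" "g'' \<le> 1"
  shows "(\<Sum>h'\<le>1. \<Sum>g'\<le>1. column_weight q s u v \<alpha> h g \<beta> h' g' * R_weight q u v h' g' h'' g'') =
         (\<Sum>h'\<le>1. \<Sum>g'\<le>1. R_weight q u v h g h' g' * column_weight q s v u \<alpha> h' g' \<beta> h'' g'')"
proof (cases "\<alpha> + h + g = \<beta> + h'' + g''")
  case False
  have "column_weight q s u v \<alpha> h g \<beta> h' g' * R_weight q u v h' g' h'' g'' = 0"
     "R_weight q u v h g h' g' * column_weight q s v u \<alpha> h' g' \<beta> h'' g'' = 0" for h' g'
    using False column_weight_nonzero R_weight_nonzero by (metis add.assoc mult_eq_0_iff)+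
  then show ?thesis by (simp only: sum.neutral_const)
next
  case True
  have "(\<Sum>h'\<le>1. \<Sum>g'\<le>1. column_weight q s u v \<alpha> h g \<beta> h' g' * R_weight q u v h' g' h'' g'') =
     (\<Sum>h'\<le>1. \<Sum>g'\<le>1. column_numerator q s u v \<alpha> h g \<beta> h' g' * R_weight q u v h' g' h'' g'') /
       ((1 - s * u) * (1 - s * v))"
    unfolding sum_divide_distrib using assms by (intro sum.cong) (simp_all add: column_weight_numerator)
  moreover have "(\<Sum>h'\<le>1. \<Sum>g'\<le>1. R_weight q u v h g h' g' * column_weight q s v u \<alpha> h' g' \<beta> h'' g'') =
     (\<Sum>h'\<le>1. \<Sum>g'\<le>1. R_weight q u v h g h' g' * column_numerator q s v u \<alpha> h' g' \<beta> h'' g'') /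
       ((1 - s * u) * (1 - s * v))"
    unfolding sum_divide_distrib using assms by (intro sum.cong) (simp_all add: column_weight_numerator)
  ultimately show ?thesis
    by (simp only: yang_baxter_numerator[OF assms True])
qed

section \<open>Moving the R-matrix through two rows\<close>

text \<open>The partition function of the first \<open>m\<close> columns of two adjacent rows, with lower edges \<open>\<alpha>\<close>,
  upper edges \<open>\<beta>\<close>, and \<open>b\<close> paths entering each row at the left.\<close>

fun two_rows :: "complex \<Rightarrow> complex \<Rightarrow> complex \<Rightarrow> complex \<Rightarrow> (nat \<Rightarrow> nat) \<Rightarrow> (nat \<Rightarrow> nat) \<Rightarrow> nat \<Rightarrow>
    nat \<Rightarrow> nat \<Rightarrow> nat \<Rightarrow> complex" where
  "two_rows q s u v \<alpha> \<beta> b 0 h g = of_bool (h = b \<and> g = b)"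
| "two_rows q s u v \<alpha> \<beta> b (Suc m) h' g' = (\<Sum>h\<le>1. \<Sum>g\<le>1. two_rows q s u v \<alpha> \<beta> b m h g *
     column_weight q s u v (\<alpha> m) h g (\<beta> m) h' g')"

text \<open>Induction on the number of columns: the R-matrix moves from the right of the last column
  to its left, and the induction hypothesis carries it on to the left boundary.\<close>

lemma two_rows_exchange:
  assumes "b \<le> 1" "h' \<le> 1" "g' \<le> 1"
  shows "(\<Sum>h\<le>1. \<Sum>g\<le>1. two_rows q s u v \<alpha> \<beta> b m h g * R_weight q u v h g h' g') =
         (v - q * u) * two_rows q s v u \<alpha> \<beta> b m h' g'"
  using assms(2,3)
proof (induction m arbitrary: h' g')
  \<comment> \<open>From the boundary state \<open>(b, b)\<close> the R-matrix leads only to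
    \<open>(b, b)\<close>, with weight \<open>v - q * u\<close>.\<close>
  case 0
  have "b = 0 \<or> b = 1" "h' = 0 \<or> h' = 1" "g' = 0 \<or> g' = 1"
    using 0 assms(1) by auto
  then show ?case
    unfolding atMost_one by (elim disjE) (simp_all add: R_weight.simps)
next
  case (Suc m)
  let ?Q = "two_rows q s u v \<alpha> \<beta> b m" and ?Q' = "two_rows q s v u \<alpha> \<beta> b m"
  let ?C = "\<lambda>h g h' g'. column_weight q s u v (\<alpha> m) h g (\<beta> m) h' g'"
  let ?C' = "\<lambda>h g h' g'. column_weight q s v u (\<alpha> m) h g (\<beta> m) h' g'"
  let ?R = "R_weight q u v"
  have swap: "(\<Sum>x\<le>1. \<Sum>y\<le>1. (\<Sum>h\<le>1. \<Sum>g\<le>1. f h g * k h g x y) * l x y) =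
      (\<Sum>h\<le>1. \<Sum>g\<le>1. f h g * (\<Sum>x\<le>1. \<Sum>y\<le>1. k h g x y * l x y))"
    for f l :: "nat \<Rightarrow> nat \<Rightarrow> complex" and k
    unfolding atMost_one by (simp add: algebra_simps)
  have "(\<Sum>x\<le>1. \<Sum>y\<le>1. two_rows q s u v \<alpha> \<beta> b (Suc m) x y * ?R x y h' g') =
      (\<Sum>h\<le>1. \<Sum>g\<le>1. ?Q h g * (\<Sum>x\<le>1. \<Sum>y\<le>1. ?C h g x y * ?R x y h' g'))"
    by (simp only: two_rows.simps swap)
  \<comment> \<open>Here the R-matrix passes the last column, and the variables in that column
    change places.\<close>
  also have "\<dots> = (\<Sum>h\<le>1. \<Sum>g\<le>1. ?Q h g * (\<Sum>x\<le>1. \<Sum>y\<le>1. ?R h g x y * ?C' x y h' g'))"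
    using Suc.prems by (intro sum.cong refl arg_cong2[where f = "(*)"] yang_baxter) auto
  also have "\<dots> = (\<Sum>x\<le>1. \<Sum>y\<le>1. (\<Sum>h\<le>1. \<Sum>g\<le>1. ?Q h g * ?R h g x y) * ?C' x y h' g')"
    by (simp only: swap)
  also have "\<dots> = (\<Sum>x\<le>1. \<Sum>y\<le>1. ((v - q * u) * ?Q' x y) * ?C' x y h' g')"
    using Suc.IH by (intro sum.cong refl arg_cong2[where f = "(*)"]) auto
  also have "\<dots> = (v - q * u) * two_rows q s v u \<alpha> \<beta> b (Suc m) h' g'"
    by (simp only: two_rows.simps sum_distrib_left mult.assoc)
  finally show ?case .
qed

text \<open>The case distinctions in \<open>vertex_numerator\<close> depend on the edge numbers
  only, not on the variable in which continuity is wanted.\<close>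

lemma continuous_if_const:
  assumes "continuous net f" "continuous net g"
  shows "continuous net (\<lambda>x. if P then f x else g x)"
  using assms by (cases P) simp_all

lemma isCont_vertex_weight:
  assumes "1 - s * u \<noteq> 0"
  shows "isCont (\<lambda>u. vertex_weight q s u x) u"
proof (cases x)
  case (fields i1 j1 i2 j2)
  have "isCont (\<lambda>u. vertex_numerator q s u x) u"
    unfolding fields vertex_numerator.simps
    by (intro continuous_if_const continuous_intros)
  then show ?thesis
    unfolding vertex_weight_numerator using assms by (intro continuous_intros) auto
qed

lemma isCont_two_rows:
  assumes "1 - s * v \<noteq> 0"
  shows "isCont (\<lambda>v. two_rows q s u v \<alpha> \<beta> b m h g) v"
    and "isCont (\<lambda>v. two_rows q s v u \<alpha> \<beta> b m h g) v"
proof -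
  have w: "isCont (\<lambda>v. vertex_weight q s v x) v" for x
    by (rule isCont_vertex_weight[OF assms])
  have C: "isCont (\<lambda>v. column_weight q s u v a h g c h' g') v"
    "isCont (\<lambda>v. column_weight q s v u a h g c h' g') v" for a h g c h' g'
    unfolding column_weight_def by (intro continuous_sum continuous_mult continuous_const w)+
  show "isCont (\<lambda>v. two_rows q s u v \<alpha> \<beta> b m h g) v"
    by (induction m arbitrary: h g)
      (simp, simp only: two_rows.simps, intro continuous_sum continuous_mult C)
  show "isCont (\<lambda>v. two_rows q s v u \<alpha> \<beta> b m h g) v"
    by (induction m arbitrary: h g)
      (simp, simp only: two_rows.simps, intro continuous_sum continuous_mult C)
qed

text \<open>At \<open>v = q * u\<close> the factor in the exchange relation vanishes, and continuity in \<open>v\<close> is used instead.\<close>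

lemma two_rows_commute:
  assumes "b \<le> 1" "1 - s * v \<noteq> 0"
  shows "two_rows q s u v \<alpha> \<beta> b m 0 0 = two_rows q s v u \<alpha> \<beta> b m 0 0"
proof -
  define D where "D v = two_rows q s u v \<alpha> \<beta> b m 0 0 - two_rows q s v u \<alpha> \<beta> b m 0 0" for v
  \<comment> \<open>At the empty right boundary only \<open>h = g = 0\<close> contributes to the sum
    with the R-matrix, again with weight \<open>v - q * u\<close>.\<close>
  have "(v - q * u) * two_rows q s u v \<alpha> \<beta> b m 0 0 = (v - q * u) * two_rows q s v u \<alpha> \<beta> b m 0 0" for v
    using two_rows_exchange[OF assms(1), of 0 0 q s u v \<alpha> \<beta> m]
    unfolding atMost_one by (simp add: R_weight.simps mult.commute)
  then have D0: "D x = 0" if "x \<noteq> q * u" for x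
    using that by (auto simp: D_def)
  have "D v = 0"
  proof (cases "v = q * u")
    case True
    \<comment> \<open>Only \<open>v\<close> varies while \<open>u\<close> is kept fixed, so
      \<open>1 - s * v \<noteq> 0\<close> suffices.\<close>
    have "isCont D v"
      unfolding D_def using assms(2) by (intro continuous_intros isCont_two_rows)
    then have "(D \<longlongrightarrow> D v) (at v)" by (simp add: isCont_def)
    moreover have "\<forall>\<^sub>F x in at v. D x = 0"
      unfolding eventually_at using D0 True by (intro exI[of _ 1]) auto
    then have "(D \<longlongrightarrow> 0) (at v)" by (simp add: tendsto_eventually)
    ultimately show ?thesis by (rule tendsto_unique[rotated]) simp
  qed (rule D0)
  then show ?thesis by (simp add: D_def)
qed

subsection \<open>Edge multisets of path collections\<close>

text \<open>\<open>X - S\<close> consists of the edges that have a predecessor in their path, \<open>X - E\<close> of those that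
  have a successor.\<close>

definition flows :: "edge multiset \<Rightarrow> edge multiset \<Rightarrow> edge multiset set" where
  "flows S E = {X. (\<forall>e\<in>#X. up_right_step (fst e) (snd e)) \<and> S \<subseteq># X \<and> E \<subseteq># X \<and>
     image_mset fst (X - S) = image_mset snd (X - E)}"

text \<open>Defined for arbitrary functions on edges, so that it also applies to assignments that do
  not come from paths.\<close>

definition numbers_at :: "(edge \<Rightarrow> nat) \<Rightarrow> vertex \<Rightarrow> nat \<times> nat \<times> nat \<times> nat" where
  "numbers_at f v = (case v of (i, j) \<Rightarrow>
     (f ((i, j - 1), (i, j)), f ((i - 1, j), (i, j)), f ((i, j), (i, j + 1)), f ((i, j), (i + 1, j))))"

text \<open>The coordinate sum strictly increases along the path.\<close>

lemma up_right_path_distinct: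
  assumes "up_right_path p"
  shows "distinct p"
proof -
  have "successively (\<lambda>v w. fst v + snd v < fst w + snd w) p"
    using assms unfolding up_right_path_def
    by (auto elim!: successively_mono simp: up_right_step_def)
  then have "sorted_wrt (\<lambda>v w. fst v + snd v < fst w + snd w) p"
    by (subst (asm) successively_conv_sorted_wrt) (auto simp: transp_def)
  then show ?thesis
    by (induction p) auto
qed

lemma path_edges_snoc: "p \<noteq> [] \<Longrightarrow> path_edges (p @ [v]) = path_edges p @ [(last p, v)]"
  unfolding path_edges_def
  by (induction p rule: induct_list012) auto

lemma path_edges_ne: "2 \<le> length p \<Longrightarrow> path_edges p \<noteq> []"
  by (cases p; cases "tl p") (auto simp: path_edges_def)

text \<open>The first two claims are conservation for a single path: its inner vertices are the
  starts of all edges but the first and the ends of all edges but the last.\<close>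

lemma
  assumes "2 \<le> length p"
  shows fst_tl_path_edges: "map fst (tl (path_edges p)) = butlast (tl p)"
    and snd_butlast_path_edges: "map snd (butlast (path_edges p)) = butlast (tl p)"
    and snd_last_path_edges: "snd (last (path_edges p)) = last p"
    and snd_hd_path_edges: "snd (hd (path_edges p)) = hd (tl p)"
    and fst_last_path_edges: "fst (last (path_edges p)) = last (butlast p)"
proof -
  obtain x y zs where p: "p = x # y # zs"
    using assms by (cases p; cases "tl p") auto
  show "map fst (tl (path_edges p)) = butlast (tl p)"
    "map snd (butlast (path_edges p)) = butlast (tl p)"
    by (auto intro!: nth_equalityI simp: path_edges_def nth_tl nth_butlast)
  show "snd (hd (path_edges p)) = hd (tl p)"
    by (simp_all add: p path_edges_def)
  have "path_edges p ! (length p - 2) = (p ! (length p - 2), p ! (length p - 1))"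
    using assms by (auto simp: path_edges_def nth_tl Suc_diff_Suc numeral_2_eq_2)
  moreover have "last (path_edges p) = path_edges p ! (length p - 2)"
    using path_edges_ne[OF assms]
    by (simp add: last_conv_nth) (simp add: path_edges_def numeral_2_eq_2)
  moreover have "last p = p ! (length p - 1)"
    by (simp add: p last_conv_nth)
  moreover have "butlast p \<noteq> []"
    using assms by (simp flip: length_0_conv)
  then have "last (butlast p) = p ! (length p - 2)"
    using assms by (simp add: last_conv_nth nth_butlast numeral_2_eq_2)
  ultimately show "snd (last (path_edges p)) = last p" "fst (last (path_edges p)) = last (butlast p)"
    by simp_all
qed

lemma path_edges_step:
  assumes "up_right_path p" "e \<in> set (path_edges p)"
  shows "up_right_step (fst e) (snd e)"
  using assms unfolding up_right_path_def path_edges_def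
  by (auto simp: successively_conv_nth in_set_conv_nth nth_tl)

lemma distinct_path_edges: "distinct p \<Longrightarrow> distinct (path_edges p)"
  unfolding path_edges_def by (rule distinct_zipI1)

definition edges_of :: "vertex list multiset \<Rightarrow> edge multiset" where
  "edges_of C = (\<Sum>p\<in>#C. mset (path_edges p))"

text \<open>Counting paths through an edge agrees with counting its occurrences because no path uses
  an edge twice.\<close>

lemma edge_count_eq:
  assumes "\<forall>p\<in>#C. up_right_path p"
  shows "edge_count C e = count (edges_of C) e"
  using assms
proof (induction C)
  case (add p C)
  have "distinct (path_edges p)"
    using add.prems by (auto intro: distinct_path_edges up_right_path_distinct)
  then have "count (mset (path_edges p)) e = (if e \<in> set (path_edges p) then 1 else 0)"
    by (metis distinct_count_atmost_1)
  with add show ?case by (auto simp: edge_count_def edges_of_def)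
qed (simp add: edge_count_def edges_of_def)

text \<open>Everything is additive over the paths, so a single induction on \<open>C\<close> reduces
  the four claims to one path.\<close>

lemma edges_of_decompose:
  assumes "\<forall>p\<in>#C. up_right_path p"
  shows "edges_of C = image_mset (\<lambda>p. hd (path_edges p)) C + (\<Sum>p\<in>#C. mset (tl (path_edges p)))"
    and "edges_of C = image_mset (\<lambda>p. last (path_edges p)) C + (\<Sum>p\<in>#C. mset (butlast (path_edges p)))"
    and "image_mset fst (\<Sum>p\<in>#C. mset (tl (path_edges p))) =
         image_mset snd (\<Sum>p\<in>#C. mset (butlast (path_edges p)))"
    and "interior_vertices C = fst ` set_mset (\<Sum>p\<in>#C. mset (tl (path_edges p)))"
proof -
  have "edges_of C = image_mset (\<lambda>p. hd (path_edges p)) C + (\<Sum>p\<in>#C. mset (tl (path_edges p))) \<and>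
    edges_of C = image_mset (\<lambda>p. last (path_edges p)) C + (\<Sum>p\<in>#C. mset (butlast (path_edges p))) \<and>
    image_mset fst (\<Sum>p\<in>#C. mset (tl (path_edges p))) =
         image_mset snd (\<Sum>p\<in>#C. mset (butlast (path_edges p))) \<and>
    interior_vertices C = fst ` set_mset (\<Sum>p\<in>#C. mset (tl (path_edges p)))"
    using assms
  proof (induction C)
    case (add p C)
    have p: "up_right_path p" and len: "2 \<le> length p"
      using add.prems by (auto simp: up_right_path_def)
    note ne = path_edges_ne[OF len]
    have 1: "mset (path_edges p) = add_mset (hd (path_edges p)) (mset (tl (path_edges p)))"
      using ne by (metis list.collapse mset.simps(2))
    have 2: "mset (path_edges p) = add_mset (last (path_edges p)) (mset (butlast (path_edges p)))"
      using ne by (metis append_butlast_last_id mset.simps(1,2) mset_append union_mset_add_mset_right add_0_right)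
    have 3: "image_mset fst (mset (tl (path_edges p))) = image_mset snd (mset (butlast (path_edges p)))"
      by (metis fst_tl_path_edges[OF len] snd_butlast_path_edges[OF len] mset_map)
    \<comment> \<open>A path consists of its first vertex, the inner vertices and its last vertex;
      distinctness keeps the two end vertices from recurring among the inner ones.\<close>
    have 4: "set p - {hd p, last p} = fst ` set (tl (path_edges p))"
    proof -
      obtain x y zs where xy: "p = x # y # zs"
        using len by (cases p; cases "tl p") auto
      have "set p = insert x (insert (last p) (set (butlast (tl p))))"
      proof -
        have "set (y # zs) = set (butlast (y # zs) @ [last (y # zs)])"
          by (subst append_butlast_last_id) auto
        then show ?thesis unfolding xy by (auto simp del: butlast.simps)
      qed
      moreover have "x \<notin> set (butlast (tl p))"
        using up_right_path_distinct[OF p] unfolding xy by (auto dest: in_set_butlastD)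
      moreover have "distinct (butlast (y # zs) @ [last (y # zs)])"
        using up_right_path_distinct[OF p] unfolding xy by (subst append_butlast_last_id) auto
      then have "last p \<notin> set (butlast (tl p))"
        unfolding xy by (auto simp del: butlast.simps)
      ultimately have "set p - {hd p, last p} = set (butlast (tl p))"
        by (auto simp: xy)
      then show ?thesis by (metis fst_tl_path_edges[OF len] list.set_map)
    qed
    have IH: "edges_of C = image_mset (\<lambda>p. hd (path_edges p)) C + (\<Sum>p\<in>#C. mset (tl (path_edges p)))"
      "edges_of C = image_mset (\<lambda>p. last (path_edges p)) C + (\<Sum>p\<in>#C. mset (butlast (path_edges p)))"
      "image_mset fst (\<Sum>p\<in>#C. mset (tl (path_edges p))) =
         image_mset snd (\<Sum>p\<in>#C. mset (butlast (path_edges p)))"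
      "interior_vertices C = fst ` set_mset (\<Sum>p\<in>#C. mset (tl (path_edges p)))"
      using add by auto
    have e: "edges_of (add_mset p C) = mset (path_edges p) + edges_of C"
      and i: "interior_vertices (add_mset p C) = (set p - {hd p, last p}) \<union> interior_vertices C"
      by (simp_all add: edges_of_def interior_vertices_def)
    show ?case
    proof (intro conjI)
      show "edges_of (add_mset p C) = image_mset (\<lambda>p. hd (path_edges p)) (add_mset p C) +
          (\<Sum>p\<in>#add_mset p C. mset (tl (path_edges p)))"
        unfolding e 1 IH(1) by simp
      show "edges_of (add_mset p C) = image_mset (\<lambda>p. last (path_edges p)) (add_mset p C) +
          (\<Sum>p\<in>#add_mset p C. mset (butlast (path_edges p)))"
        unfolding e 2 IH(2) by simp
    qed (simp_all only: i 3 4 IH(3,4) image_mset_union sum_mset.add_mset set_mset_union image_Un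
        image_mset_add_mset set_mset_mset)
  qed (simp add: edges_of_def interior_vertices_def)
  then show "edges_of C = image_mset (\<lambda>p. hd (path_edges p)) C + (\<Sum>p\<in>#C. mset (tl (path_edges p)))"
    and "edges_of C = image_mset (\<lambda>p. last (path_edges p)) C + (\<Sum>p\<in>#C. mset (butlast (path_edges p)))"
    and "image_mset fst (\<Sum>p\<in>#C. mset (tl (path_edges p))) =
         image_mset snd (\<Sum>p\<in>#C. mset (butlast (path_edges p)))"
    and "interior_vertices C = fst ` set_mset (\<Sum>p\<in>#C. mset (tl (path_edges p)))" by auto
qed

lemma edges_of_in_flows:
  assumes "C \<in> path_collections S E"
  shows "edges_of C \<in> flows S E" "interior_vertices C = fst ` set_mset (edges_of C - S)"
proof -
  have C: "\<forall>p\<in>#C. up_right_path p" and SE: "image_mset (\<lambda>p. hd (path_edges p)) C = S"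
    "image_mset (\<lambda>p. last (path_edges p)) C = E"
    using assms by (auto simp: path_collections_def)
  note D = edges_of_decompose[OF C, unfolded SE]
  have sub: "edges_of C - S = (\<Sum>p\<in>#C. mset (tl (path_edges p)))"
    "edges_of C - E = (\<Sum>p\<in>#C. mset (butlast (path_edges p)))"
    using D(1,2) by (metis add_diff_cancel_left')+
  have "\<forall>e\<in>#edges_of C. up_right_step (fst e) (snd e)"
    using C path_edges_step by (fastforce simp: edges_of_def)
  moreover have "S \<subseteq># edges_of C" "E \<subseteq># edges_of C"
    using D(1,2) by (metis mset_subset_eq_add_left)+
  ultimately show "edges_of C \<in> flows S E"
    using sub D(3) by (simp add: flows_def)
  show "interior_vertices C = fst ` set_mset (edges_of C - S)"
    using sub D(4) by simp
qed

text \<open>Induction on the number of non-starting edges: a non-starting edge with maximal coordinate sum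
  must be an ending edge, so it can be cut off, making one of its predecessors an ending edge.\<close>

lemma flow_decomposition:
  assumes "X \<in> flows S E"
  shows "\<exists>C \<in> path_collections S E. edges_of C = X"
  using assms
proof (induction "size (X - S)" arbitrary: X E)
  case 0
  \<comment> \<open>Conservation makes \<open>X - E\<close> empty as well. Hence
    \<open>S = X = E\<close>, and every path is a single edge.\<close>
  then have "X - S = {#}" by simp
  with 0 have "X = S" "X - E = {#}"
    by (auto simp: flows_def subset_mset.diff_add dest: subset_mset.diff_add[of S X])
  have "E \<subseteq># X" using 0 by (simp add: flows_def)
  with \<open>X - E = {#}\<close> have "E = X" by (metis add.right_neutral subset_mset.add_diff_inverse)
  define C where "C = image_mset (\<lambda>e. [fst e, snd e]) X"
  have "C \<in> path_collections S E"
    using 0 unfolding \<open>E = X\<close> \<open>X = S\<close>[symmetric]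
    by (auto simp: path_collections_def C_def flows_def up_right_path_def path_edges_def multiset.map_comp comp_def)
  moreover have "edges_of C = X"
    by (simp add: edges_of_def C_def path_edges_def multiset.map_comp comp_def)
  ultimately show ?case by blast
next
  case (Suc n)
  define rank :: "edge \<Rightarrow> int" where "rank e = fst (fst e) + snd (fst e)" for e
  have X: "\<forall>e\<in>#X. up_right_step (fst e) (snd e)" "S \<subseteq># X" "E \<subseteq># X"
    "image_mset fst (X - S) = image_mset snd (X - E)"
    using Suc.prems by (auto simp: flows_def)
  have "X - S \<noteq> {#}" using Suc.hyps by auto
  then have "Max (rank ` set_mset (X - S)) \<in> rank ` set_mset (X - S)"
    by (intro Max_in) auto
  then obtain e where e: "e \<in># X - S" and "rank e = Max (rank ` set_mset (X - S))" by auto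
  then have max: "rank e' \<le> rank e" if "e' \<in># X - S" for e'
    using that by simp
  have eX: "e \<in># X" using e by (meson in_diffD)
  \<comment> \<open>A non-starting edge that begins where \<open>e\<close> ends would have larger
    rank. By conservation \<open>e\<close> then does not lie in \<open>X - E\<close>, so it is an
    ending edge.\<close>
  have "snd e \<notin># image_mset fst (X - S)"
  proof
    assume "snd e \<in># image_mset fst (X - S)"
    then obtain e' where "e' \<in># X - S" "fst e' = snd e" by auto
    then show False using max[of e'] X(1) eX by (auto simp: rank_def up_right_step_def)
  qed
  then have "e \<notin># X - E" unfolding X(4) by auto
  then have eE: "e \<in># E" using eX
    by (metis diff_empty multiset_cases mset_subset_eq_single in_diff_count not_in_iff count_greater_zero_iff)
  \<comment> \<open>Conservation at the start of \<open>e\<close> supplies a predecessor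
    \<open>e'\<close> that still has a free occurrence outside \<open>E\<close>.\<close>
  have "fst e \<in># image_mset snd (X - E)" using e unfolding X(4)[symmetric] by auto
  then obtain e' where e': "e' \<in># X - E" "snd e' = fst e" by auto
  define X' where "X' = X - {#e#}"
  define E' where "E' = E - {#e#} + {#e'#}"
  have XX: "X = add_mset e X'" and EE: "E = add_mset e (E - {#e#})"
    using eX eE by (simp_all add: X'_def)
  have "e' \<noteq> e" using e' \<open>e \<notin># X - E\<close> by auto
  have lt: "count S e < count X e" "count E e' < count X e'"
    using e e'(1) by (simp_all add: in_diff_count)
  have le: "count S x \<le> count X x" "count E x \<le> count X x" for x
    using X(2,3) by (simp_all add: mset_subset_eq_count)
  have SX: "S \<subseteq># X'"
    using lt(1) le(1) by (intro mset_subset_eqI) (auto simp: X'_def)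
  have EX: "E' \<subseteq># X'"
  proof (rule mset_subset_eqI)
    show "count E' x \<le> count X' x" for x
      using lt(2) le(2)[of x] \<open>e' \<noteq> e\<close> eE by (auto simp: X'_def E'_def)
  qed
  have 1: "X - S = add_mset e (X' - S)"
    using lt(1) by (intro multiset_eqI) (auto simp: X'_def)
  have 2: "X - E = add_mset e' (X' - E')"
    using lt(2) eE \<open>e' \<noteq> e\<close> by (intro multiset_eqI) (auto simp: X'_def E'_def Suc_diff_Suc)
  have "image_mset fst (X' - S) = image_mset snd (X' - E')"
    using X(4) unfolding 1 2 using e'(2) by simp
  then have "X' \<in> flows S E'" using X SX EX by (auto simp: flows_def X'_def dest: in_diffD)
  moreover have "n = size (X' - S)" using Suc.hyps(2) 1 by simp
  ultimately obtain C where C: "C \<in> path_collections S E'" "edges_of C = X'"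
    using Suc.hyps(1) by blast
  have "e' \<in># image_mset (\<lambda>p. last (path_edges p)) C"
    using C(1) by (auto simp: path_collections_def E'_def)
  then obtain p where p: "p \<in># C" "last (path_edges p) = e'" by auto
  then obtain C0 where C0: "C = add_mset p C0" by (metis mset_add)
  have pp: "up_right_path p" and len: "2 \<le> length p" "p \<noteq> []"
    using C(1) p(1) by (auto simp: path_collections_def up_right_path_def)
  have lst: "last p = fst e"
    using snd_last_path_edges[OF len(1)] p(2) e'(2) by simp
  \<comment> \<open>The path that ends with \<open>e'\<close> is prolonged by \<open>e\<close>; all
    other paths are kept.\<close>
  define p' where "p' = p @ [snd e]"
  have pe: "path_edges p' = path_edges p @ [e]"
    unfolding p'_def using path_edges_snoc[OF len(2)] lst by simp
  have up': "up_right_path p'"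
    using pp X(1) eX lst len by (auto simp: up_right_path_def p'_def successively_append_iff)
  have "image_mset (\<lambda>p. last (path_edges p)) C0 = E - {#e#}"
    using C(1) p(2) unfolding C0 by (simp add: path_collections_def E'_def)
  moreover have "hd (path_edges p') = hd (path_edges p)"
    using path_edges_ne[OF len(1)] pe by simp
  ultimately have "add_mset p' C0 \<in> path_collections S E"
    using C(1) up' pe EE unfolding C0 by (auto simp: path_collections_def)
  moreover have "edges_of (add_mset p' C0) = X"
    using C(2) pe XX unfolding C0 by (simp add: edges_of_def)
  ultimately show ?case by blast
qed

text \<open>The configuration read off from the edge multiset alone; the interior vertices are the
  starts of the non-starting edges.\<close>

definition flow_configuration :: "edge multiset \<Rightarrow> edge multiset \<Rightarrow> (vertex \<rightharpoonup> nat \<times> nat \<times> nat \<times> nat)" where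
  "flow_configuration S X =
     (\<lambda>v. if v \<in> fst ` set_mset (X - S) then Some (numbers_at (count X) v) else None)"

lemma configuration_eq:
  assumes "C \<in> path_collections S E"
  shows "configuration C = flow_configuration S (edges_of C)"
proof -
  have "edge_numbers C v = numbers_at (count (edges_of C)) v" for v
    using assms edge_count_eq[of C] by (auto simp: edge_numbers_def numbers_at_def path_collections_def)
  then show ?thesis
    using edges_of_in_flows(2)[OF assms] unfolding configuration_def flow_configuration_def by presburger
qed

lemma configurations_eq:
  "configuration ` path_collections S E = flow_configuration S ` flows S E"
proof -
  have "flows S E = edges_of ` path_collections S E"
    using edges_of_in_flows(1)[of _ S E] flow_decomposition[of _ S E] by blast
  then show ?thesis
    using configuration_eq[of _ S E] by (simp add: image_image)
qed

text \<open>An edge that starts at an interior vertex is recorded there as North or East number. Any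
  other edge occurs only as a starting edge, with its multiplicity in \<open>S\<close>.\<close>

lemma inj_on_flow_configuration: "inj_on (flow_configuration S) (flows S E)"
proof (intro inj_onI multiset_eqI)
  fix X Y :: "edge multiset" and e :: edge
  assume XY: "X \<in> flows S E" "Y \<in> flows S E" and eq: "flow_configuration S X = flow_configuration S Y"
  have dom: "v \<in> fst ` set_mset (X - S) \<longleftrightarrow> v \<in> fst ` set_mset (Y - S)"
    and num: "v \<in> fst ` set_mset (X - S) \<Longrightarrow> numbers_at (count X) v = numbers_at (count Y) v" for v
    using fun_cong[OF eq, of v] by (auto simp: flow_configuration_def split: if_splits)
  have out: "count Z e = count S e" if "Z \<in> flows S E" "fst e \<notin> fst ` set_mset (Z - S)" for Z
  proof -
    have "e \<notin># Z - S" using that by auto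
    moreover have "count S e \<le> count Z e" using that by (auto simp: flows_def mset_subset_eq_count)
    ultimately show ?thesis by (metis count_diff le_antisym diff_is_0_eq not_in_iff)
  qed
  show "count X e = count Y e"
  proof (cases "up_right_step (fst e) (snd e)")
    case False
    then have "e \<notin># X" "e \<notin># Y" using XY by (auto simp: flows_def)
    then show ?thesis by (simp add: not_in_iff)
  next
    case True
    show ?thesis
    proof (cases "fst e \<in> fst ` set_mset (X - S)")
      case True
      obtain i j where ij: "fst e = (i, j)" by (cases "fst e")
      have "e = ((i, j), (i + 1, j)) \<or> e = ((i, j), (i, j + 1))"
        using \<open>up_right_step _ _\<close> ij by (cases e) (auto simp: up_right_step_def)
      then show ?thesis
        using num[OF True] unfolding ij by (auto simp: numbers_at_def)
    next
      case False
      with dom out[OF XY(1)] out[OF XY(2)] show ?thesis by auto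
    qed
  qed
qed

text \<open>Each configuration comes from exactly one flow, so summing over flows respects the
  identification of collections.\<close>

lemma path_sum_eq_flows:
  "path_sum q s S E u = (\<Sum>X\<in>flows S E.
     \<Prod>v\<in>fst ` set_mset (X - S). vertex_weight q s (u (nat (snd v))) (numbers_at (count X) v))"
proof -
  have dom: "dom (flow_configuration S X) = fst ` set_mset (X - S)" for X
    by (rule set_eqI) (simp only: flow_configuration_def domIff if_True if_False option.distinct simp_thms split: if_split)
  have "configuration_weight q s u (flow_configuration S X) =
      (\<Prod>v\<in>fst ` set_mset (X - S). vertex_weight q s (u (nat (snd v))) (numbers_at (count X) v))" for X
    unfolding configuration_weight_def dom
    by (intro prod.cong refl) (simp only: flow_configuration_def if_True option.sel)
  then show ?thesis
    unfolding path_sum_def configurations_eq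
    by (simp add: sum.reindex[OF inj_on_flow_configuration])
qed

lemma finite_flows: "finite (flows S E)"
  using finite_path_collections[of S E]
  by (metis configurations_eq finite_imageD finite_imageI inj_on_flow_configuration)

subsection \<open>Two adjacent rows\<close>

text \<open>The functions stay total, unlike those of \<open>PiE\<close>, so that boundary values
  and summed values are held by the same function.\<close>

definition extensions :: "('e \<Rightarrow> 'b) \<Rightarrow> 'e set \<Rightarrow> ('e \<Rightarrow> 'b set) \<Rightarrow> ('e \<Rightarrow> 'b) set" where
  "extensions f D A = {g. (\<forall>e\<in>D. g e \<in> A e) \<and> (\<forall>e. e \<notin> D \<longrightarrow> g e = f e)}"

lemma finite_extensions:
  assumes "finite D" "\<And>e. finite (A e)"
  shows "finite (extensions f D A)"
proof (rule finite_subset)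
  show "extensions f D A \<subseteq> (\<lambda>h e. if e \<in> D then h e else f e) ` PiE D A"
  proof
    fix g assume "g \<in> extensions f D A"
    then have "restrict g D \<in> PiE D A" "g = (\<lambda>e. if e \<in> D then restrict g D e else f e)"
      by (auto simp: extensions_def)
    then show "g \<in> (\<lambda>h e. if e \<in> D then h e else f e) ` PiE D A" by blast
  qed
  show "finite ((\<lambda>h e. if e \<in> D then h e else f e) ` PiE D A)"
    using assms by (intro finite_imageI finite_PiE)
qed

text \<open>An iterated sum: first the values on \<open>D'\<close> are chosen, then those on
  \<open>D\<close>. Different choices on \<open>D'\<close> have disjoint sets of extensions because
  \<open>D\<close> leaves these values untouched.\<close>

lemma sum_extensions_Un:
  fixes \<phi> :: "('e \<Rightarrow> 'b) \<Rightarrow> 'c::comm_monoid_add"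
  assumes fin: "finite D" "finite D'" "\<And>e. finite (A e)" and disj: "D \<inter> D' = {}"
  shows "(\<Sum>g\<in>extensions f (D \<union> D') A. \<phi> g) = (\<Sum>h\<in>extensions f D' A. \<Sum>g\<in>extensions h D A. \<phi> g)"
proof -
  have "extensions f (D \<union> D') A = (\<Union>h\<in>extensions f D' A. extensions h D A)" (is "?L = ?R")
  proof (intro equalityI subsetI)
    fix g assume g: "g \<in> ?L"
    then have "(\<lambda>e. if e \<in> D' then g e else f e) \<in> extensions f D' A"
      "g \<in> extensions (\<lambda>e. if e \<in> D' then g e else f e) D A"
      by (auto simp: extensions_def)
    then show "g \<in> ?R" by blast
  next
    fix g assume "g \<in> ?R"
    then show "g \<in> ?L" using disj by (auto simp: extensions_def)
  qed
  moreover have "extensions h D A \<inter> extensions h' D A = {}"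
    if h: "h \<in> extensions f D' A" "h' \<in> extensions f D' A" "h \<noteq> h'" for h h'
  proof -
    obtain e where "h e \<noteq> h' e" using h(3) by blast
    moreover from this have "e \<in> D'" using h(1,2) unfolding extensions_def by fastforce
    ultimately show ?thesis using disj by (auto simp: extensions_def) (metis disjoint_iff)
  qed
  ultimately show ?thesis
    using fin by (simp add: sum.UNION_disjoint finite_extensions)
qed

lemma sum_extensions_insert:
  fixes \<phi> :: "('e \<Rightarrow> 'b) \<Rightarrow> 'c::comm_monoid_add"
  assumes "finite D" "\<And>e. finite (A e)" "e \<notin> D"
  shows "(\<Sum>g\<in>extensions f (insert e D) A. \<phi> g) = (\<Sum>x\<in>A e. \<Sum>g\<in>extensions (f(e := x)) D A. \<phi> g)"
proof -
  have "extensions f {e} A = (\<lambda>x. f(e := x)) ` A e"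
    by (force simp: extensions_def fun_eq_iff)
  moreover have "inj_on (\<lambda>x. f(e := x)) (A e)"
    by (intro inj_onI) (metis fun_upd_same)
  ultimately show ?thesis
    using sum_extensions_Un[where D = D and D' = "{e}" and A = A and f = f and \<phi> = \<phi>] assms by (simp add: sum.reindex)
qed

section \<open>Edges inside two adjacent rows\<close>

definition vert :: "int \<Rightarrow> int \<Rightarrow> edge" where "vert i j = ((i, j), (i, j + 1))"
definition horiz :: "int \<Rightarrow> int \<Rightarrow> edge" where "horiz i j = ((i, j), (i + 1, j))"

lemma vert_horiz_simps [simp]:
  "vert i j = vert i' j' \<longleftrightarrow> i = i' \<and> j = j'" "horiz i j = horiz i' j' \<longleftrightarrow> i = i' \<and> j = j'"
  "vert i j \<noteq> horiz i' j'" "horiz i' j' \<noteq> vert i j"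
  "fst (vert i j) = (i, j)" "snd (vert i j) = (i, j + 1)"
  "fst (horiz i j) = (i, j)" "snd (horiz i j) = (i + 1, j)"
  by (auto simp: vert_def horiz_def)

lemma up_right_step_iff: "up_right_step (fst e) (snd e) \<longleftrightarrow> (\<exists>i j. e = vert i j \<or> e = horiz i j)"
  by (cases e) (auto simp: up_right_step_def vert_def horiz_def ex_disj_distrib)

lemma numbers_at_eq:
  "numbers_at f (i, j) = (f (vert i (j - 1)), f (horiz (i - 1) j), f (vert i j), f (horiz i j))"
  by (simp add: numbers_at_def vert_def horiz_def)

text \<open>The bound on vertical edges grows with the height, because each vertex of nonzero weight can
  increase the vertical edge number by one; this leaves the sum over the edge between two rows
  complete.\<close>

definition edge_range :: "nat \<Rightarrow> edge \<Rightarrow> nat set" where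
  "edge_range N e = (if snd (fst e) = snd (snd e) then {..1} else {..N + nat (snd (fst e))})"

lemma edge_range_simps [simp]:
  "edge_range N (horiz i j) = {..1}" "edge_range N (vert i j) = {..N + nat j}"
  by (simp_all add: edge_range_def)

lemma finite_edge_range [simp]: "finite (edge_range N e)"
  by (simp add: edge_range_def)

definition column_product ::
    "complex \<Rightarrow> complex \<Rightarrow> complex \<Rightarrow> complex \<Rightarrow> int \<Rightarrow> (edge \<Rightarrow> nat) \<Rightarrow> int \<Rightarrow> complex" where
  "column_product q s u v r f i =
     vertex_weight q s u (numbers_at f (i, r)) * vertex_weight q s v (numbers_at f (i, r + 1))"

text \<open>For every column, the edge between the two rows and the two horizontal edges entering
  from the left. The left boundary edges are included and the right ones are not, so a new column
  adds exactly three edges.\<close>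

definition strip :: "int \<Rightarrow> int \<Rightarrow> nat \<Rightarrow> edge set" where
  "strip a r m = (\<lambda>i. vert i r) ` {a..<a + int m} \<union>
     (\<lambda>(i, j). horiz i j) ` ({a - 1..<a + int m - 1} \<times> {r, r + 1})"

lemma finite_strip [simp]: "finite (strip a r m)"
  by (simp add: strip_def)

lemma strip_Suc:
  "strip a r (Suc m) = insert (horiz (a + int m - 1) r) (insert (horiz (a + int m - 1) (r + 1))
     (insert (vert (a + int m) r) (strip a r m)))"
proof -
  have "{a..<a + int (Suc m)} = insert (a + int m) {a..<a + int m}"
    "{a - 1..<a + int (Suc m) - 1} = insert (a + int m - 1) {a - 1..<a + int m - 1}" by auto
  then show ?thesis by (auto simp: strip_def)
qed

lemma vert_in_strip: "vert i j \<in> strip a r m \<longleftrightarrow> j = r \<and> a \<le> i \<and> i < a + int m"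
  and horiz_in_strip: "horiz i j \<in> strip a r m \<longleftrightarrow> (j = r \<or> j = r + 1) \<and> a - 1 \<le> i \<and> i < a + int m - 1"
  by (auto simp: strip_def)

text \<open>Induction on the columns, following the recursion of \<open>two_rows\<close>. The left
  boundary edges are summed over too, and the indicator fixes them to \<open>b\<close>, which is the
  initial value of the recursion.\<close>

lemma sum_strip_eq_two_rows:
  assumes "\<And>i. i \<in> {a..<a + int m} \<Longrightarrow> g (vert i (r - 1)) + 1 \<le> N + nat r"
  shows "(\<Sum>f\<in>extensions g (strip a r m) (edge_range N).
       of_bool (f (horiz (a - 1) r) = b \<and> f (horiz (a - 1) (r + 1)) = b) *
       (\<Prod>i\<in>{a..<a + int m}. column_product q s u v r f i)) =
     two_rows q s u v (\<lambda>c. g (vert (a + int c) (r - 1))) (\<lambda>c. g (vert (a + int c) (r + 1))) b m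
       (g (horiz (a + int m - 1) r)) (g (horiz (a + int m - 1) (r + 1)))"
  using assms
proof (induction m arbitrary: g)
  case 0
  have "extensions g (strip a r 0) (edge_range N) = {g}"
    by (auto simp: extensions_def strip_def)
  then show ?case by simp
next
  case (Suc m)
  define A where "A = edge_range N"
  define \<phi> where "\<phi> f = (of_bool (f (horiz (a - 1) r) = b \<and> f (horiz (a - 1) (r + 1)) = b) :: complex)" for f
  let ?P = "\<lambda>f. \<Prod>i\<in>{a..<a + int m}. column_product q s u v r f i"
  let ?i = "a + int m"
  let ?eh = "horiz (?i - 1) r" and ?eg = "horiz (?i - 1) (r + 1)" and ?ev = "vert ?i r"
  let ?\<alpha> = "\<lambda>c. g (vert (a + int c) (r - 1))" and ?\<beta> = "\<lambda>c. g (vert (a + int c) (r + 1))"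
  \<comment> \<open>The three edges added by the last column are fixed first; the sum over the
    smaller strip is then covered by the induction hypothesis.\<close>
  define g' where "g' h k l = g(?eh := h, ?eg := k, ?ev := l)" for h k l
  let ?w = "\<lambda>h k l. vertex_weight q s u (?\<alpha> m, h, l, g (horiz ?i r)) *
      vertex_weight q s v (l, k, ?\<beta> m, g (horiz ?i (r + 1)))"
  have inner: "(\<Sum>f\<in>extensions (g' h k l) (strip a r m) A. \<phi> f * ?P f * column_product q s u v r f ?i) =
      two_rows q s u v ?\<alpha> ?\<beta> b m h k * ?w h k l" for h k l
  proof -
    have "column_product q s u v r f ?i = ?w h k l" if "f \<in> extensions (g' h k l) (strip a r m) A" for f
    proof -
      have f: "f e = g' h k l e" if "e \<notin> strip a r m" for e
        using \<open>f \<in> _\<close> that unfolding extensions_def by blast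
      have "f (vert ?i (r - 1)) = ?\<alpha> m" "f (horiz (?i - 1) r) = h" "f (vert ?i r) = l"
        "f (horiz ?i r) = g (horiz ?i r)" "f (horiz (?i - 1) (r + 1)) = k"
        "f (vert ?i (r + 1)) = ?\<beta> m" "f (horiz ?i (r + 1)) = g (horiz ?i (r + 1))"
        by (simp_all add: f vert_in_strip horiz_in_strip g'_def)
      then show ?thesis by (simp add: column_product_def numbers_at_eq)
    qed
    then have "(\<Sum>f\<in>extensions (g' h k l) (strip a r m) A. \<phi> f * ?P f * column_product q s u v r f ?i) =
        (\<Sum>f\<in>extensions (g' h k l) (strip a r m) A. \<phi> f * ?P f) * ?w h k l"
      by (simp add: sum_distrib_right)
    also have "(\<Sum>f\<in>extensions (g' h k l) (strip a r m) A. \<phi> f * ?P f) =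
        two_rows q s u v (\<lambda>c. g' h k l (vert (a + int c) (r - 1))) (\<lambda>c. g' h k l (vert (a + int c) (r + 1))) b m
       (g' h k l ?eh) (g' h k l ?eg)"
      unfolding \<phi>_def A_def using Suc.prems by (intro Suc.IH) (auto simp: g'_def)
    also have "\<dots> = two_rows q s u v ?\<alpha> ?\<beta> b m h k"
      by (simp add: g'_def)
    finally show ?thesis .
  qed
  \<comment> \<open>The assumed bound makes \<open>{..N + nat r}\<close> contain all
    \<open>l \<le> ?\<alpha> m + 1\<close>; beyond these, conservation makes the terms
    vanish.\<close>
  have column: "(\<Sum>l\<le>N + nat r. ?w h k l) =
      column_weight q s u v (?\<alpha> m) h k (?\<beta> m) (g (horiz ?i r)) (g (horiz ?i (r + 1)))" if "h \<le> 1" for h k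
    unfolding column_weight_def using Suc.prems[of ?i] that
    by (intro sum.mono_neutral_right) (auto simp: vertex_weight_eq_0)
  have "{a..<a + int (Suc m)} = insert ?i {a..<a + int m}" by auto
  then have "(\<Prod>i\<in>{a..<a + int (Suc m)}. column_product q s u v r f i) = ?P f * column_product q s u v r f ?i" for f
    by simp
  then have "(\<Sum>f\<in>extensions g (strip a r (Suc m)) A. \<phi> f *
       (\<Prod>i\<in>{a..<a + int (Suc m)}. column_product q s u v r f i)) =
     (\<Sum>f\<in>extensions g (strip a r (Suc m)) A. \<phi> f * ?P f * column_product q s u v r f ?i)"
    by (simp add: mult.assoc)
  also have "\<dots> = (\<Sum>h\<le>1. \<Sum>k\<le>1. \<Sum>l\<le>N + nat r.
      \<Sum>f\<in>extensions (g' h k l) (strip a r m) A. \<phi> f * ?P f * column_product q s u v r f ?i)"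
    unfolding strip_Suc A_def g'_def
    by (subst sum_extensions_insert;
        (simp only: finite_insert finite_strip finite_edge_range insert_iff vert_in_strip horiz_in_strip edge_range_simps)?;
        (simp; fail)?)+
  also have "\<dots> = (\<Sum>h\<le>1. \<Sum>k\<le>1. two_rows q s u v ?\<alpha> ?\<beta> b m h k * (\<Sum>l\<le>N + nat r. ?w h k l))"
    by (simp only: inner sum_distrib_left)
  also have "\<dots> = two_rows q s u v ?\<alpha> ?\<beta> b (Suc m) (g (horiz ?i r)) (g (horiz ?i (r + 1)))"
    unfolding two_rows.simps by (intro sum.cong refl arg_cong2[where f = "(*)"] column) simp
  finally show ?case unfolding \<phi>_def A_def by simp
qed

subsection \<open>Partition functions on a box\<close>

definition box :: "int \<Rightarrow> nat \<Rightarrow> nat \<Rightarrow> vertex set" where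
  "box a m n = {a..<a + int m} \<times> {1..int n}"

definition inner_edges :: "int \<Rightarrow> nat \<Rightarrow> nat \<Rightarrow> edge set" where
  "inner_edges a m n = {e. up_right_step (fst e) (snd e) \<and> fst e \<in> box a m n \<and> snd e \<in> box a m n}"

definition box_weight :: "complex \<Rightarrow> complex \<Rightarrow> int \<Rightarrow> nat \<Rightarrow> nat \<Rightarrow> (nat \<Rightarrow> complex) \<Rightarrow> (edge \<Rightarrow> nat) \<Rightarrow> complex" where
  "box_weight q s a m n u f = (\<Prod>v\<in>box a m n. vertex_weight q s (u (nat (snd v))) (numbers_at f v))"

definition box_sum :: "complex \<Rightarrow> complex \<Rightarrow> int \<Rightarrow> nat \<Rightarrow> nat \<Rightarrow> nat \<Rightarrow> (edge \<Rightarrow> nat) \<Rightarrow> (nat \<Rightarrow> complex) \<Rightarrow> complex" where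
  "box_sum q s a m n N f0 u =
     (\<Sum>f\<in>extensions f0 (inner_edges a m n) (edge_range N). box_weight q s a m n u f)"

lemma finite_box [simp]: "finite (box a m n)"
  by (simp add: box_def)

lemma finite_inner_edges [simp]: "finite (inner_edges a m n)"
  by (rule finite_subset[of _ "box a m n \<times> box a m n"]) (auto simp: inner_edges_def)

lemma vert_in_inner_edges:
    "vert i j \<in> inner_edges a m n \<longleftrightarrow> i \<in> {a..<a + int m} \<and> 1 \<le> j \<and> j < int n"
  and horiz_in_inner_edges:
    "horiz i j \<in> inner_edges a m n \<longleftrightarrow> a \<le> i \<and> i < a + int m - 1 \<and> j \<in> {1..int n}"
  unfolding inner_edges_def up_right_step_iff by (auto simp: box_def)

lemma box_weight_split:
  assumes "1 \<le> r" "r < n"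
  shows "box_weight q s a m n u f =
     (\<Prod>v\<in>{v \<in> box a m n. snd v \<noteq> int r \<and> snd v \<noteq> int r + 1}.
        vertex_weight q s (u (nat (snd v))) (numbers_at f v)) *
     (\<Prod>i\<in>{a..<a + int m}. column_product q s (u r) (u (Suc r)) (int r) f i)"
proof -
  let ?w = "\<lambda>v. vertex_weight q s (u (nat (snd v))) (numbers_at f v)"
  let ?I = "{a..<a + int m}"
  have "box a m n = {v \<in> box a m n. snd v \<noteq> int r \<and> snd v \<noteq> int r + 1} \<union> ?I \<times> {int r, int r + 1}"
    using assms by (auto simp: box_def)
  then have "box_weight q s a m n u f =
      prod ?w ({v \<in> box a m n. snd v \<noteq> int r \<and> snd v \<noteq> int r + 1} \<union> ?I \<times> {int r, int r + 1})"
    by (simp only: box_weight_def)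
  also have "\<dots> = prod ?w {v \<in> box a m n. snd v \<noteq> int r \<and> snd v \<noteq> int r + 1} *
      prod ?w (?I \<times> {int r, int r + 1})"
    by (rule prod.union_disjoint) auto
  also have "prod ?w (?I \<times> {int r, int r + 1}) = (\<Prod>i\<in>?I. \<Prod>j\<in>{int r, int r + 1}. ?w (i, j))"
    by (subst prod.cartesian_product) (simp add: case_prod_unfold)
  also have "\<dots> = (\<Prod>i\<in>?I. column_product q s (u r) (u (Suc r)) (int r) f i)"
    by (simp add: column_product_def nat_add_distrib)
  finally show ?thesis .
qed

text \<open>The edges inside rows \<open>r\<close> and \<open>r + 1\<close> are summed last, for
  fixed values elsewhere. Their sum is a value of \<open>two_rows\<close>, symmetric in the two
  variables, and the remaining factor contains neither of them.\<close>

lemma box_sum_swap: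
  assumes r: "1 \<le> r" "r < n" and u: "1 - s * u (Suc r) \<noteq> 0"
    and b: "b \<le> 1"
    and left: "\<And>j. j \<in> {1..int n} \<Longrightarrow> f0 (horiz (a - 1) j) = b"
    and right: "\<And>j. j \<in> {1..int n} \<Longrightarrow> f0 (horiz (a + int m - 1) j) = 0"
    and bottom: "\<And>i. i \<in> {a..<a + int m} \<Longrightarrow> f0 (vert i 0) \<le> N"
  shows "box_sum q s a m n N f0 (u \<circ> transpose r (Suc r)) = box_sum q s a m n N f0 u"
proof -
  define mid where "mid = inner_edges a m n \<inter> strip a (int r) m"
  define rest where "rest = inner_edges a m n - strip a (int r) m"
  define outer where "outer w f = (\<Prod>v\<in>{v \<in> box a m n. snd v \<noteq> int r \<and> snd v \<noteq> int r + 1}.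
        vertex_weight q s (w (nat (snd v))) (numbers_at f v))" for w f
  have inner: "inner_edges a m n = mid \<union> rest" and fin: "finite mid" "finite rest" and disj: "mid \<inter> rest = {}"
    by (auto simp: mid_def rest_def)
  have outer: "outer w f = outer w g" if "f \<in> extensions g mid (edge_range N)" for w f g
    unfolding outer_def
  proof (intro prod.cong refl)
    fix v assume v: "v \<in> {v \<in> box a m n. snd v \<noteq> int r \<and> snd v \<noteq> int r + 1}"
    have "f e = g e" if "e \<notin> strip a (int r) m" for e
      using \<open>f \<in> _\<close> that unfolding extensions_def mid_def by blast
    then have "numbers_at f v = numbers_at g v"
      using v by (cases v) (simp add: numbers_at_eq vert_in_strip horiz_in_strip)
    then show "vertex_weight q s (w (nat (snd v))) (numbers_at f v) =
        vertex_weight q s (w (nat (snd v))) (numbers_at g v)" by simp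
  qed
  have outer_swap: "outer (u \<circ> transpose r (Suc r)) g = outer u g" for g
    unfolding outer_def
  proof (intro prod.cong refl)
    fix v assume "v \<in> {v \<in> box a m n. snd v \<noteq> int r \<and> snd v \<noteq> int r + 1}"
    then have "nat (snd v) \<noteq> r" "nat (snd v) \<noteq> Suc r" by (auto simp: box_def)
    then show "vertex_weight q s ((u \<circ> transpose r (Suc r)) (nat (snd v))) (numbers_at g v) =
        vertex_weight q s (u (nat (snd v))) (numbers_at g v)"
      by (simp add: transpose_apply_other)
  qed
  have strip_sum: "(\<Sum>f\<in>extensions g mid (edge_range N). \<Prod>i\<in>{a..<a + int m}. column_product q s x y (int r) f i) =
      two_rows q s x y (\<lambda>c. g (vert (a + int c) (int r - 1))) (\<lambda>c. g (vert (a + int c) (int r + 1))) b m 0 0"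
    if g: "g \<in> extensions f0 rest (edge_range N)" for g x y
  proof -
    have g_out: "g e = f0 e" if "e \<notin> inner_edges a m n" for e
      using g that unfolding extensions_def rest_def by blast
    have lr: "g (horiz (a - 1) (int r)) = b" "g (horiz (a - 1) (int r + 1)) = b"
      "g (horiz (a + int m - 1) (int r)) = 0" "g (horiz (a + int m - 1) (int r + 1)) = 0"
      using r left right by (simp_all add: g_out horiz_in_inner_edges)
    \<comment> \<open>Below row \<open>1\<close> lies the boundary, bounded by \<open>N\<close>;
      below a later row \<open>r\<close> the range is \<open>N + (r - 1)\<close>. Either way one
      more path still fits into the range above row \<open>r\<close>.\<close>
    have cap: "g (vert i (int r - 1)) + 1 \<le> N + nat (int r)" if i: "i \<in> {a..<a + int m}" for i
    proof (cases "r = 1")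
      case True
      then show ?thesis using bottom[OF i] by (simp add: g_out vert_in_inner_edges)
    next
      case False
      then have "vert i (int r - 1) \<in> rest"
        using r i by (auto simp: rest_def vert_in_inner_edges vert_in_strip)
      then have "g (vert i (int r - 1)) \<in> edge_range N (vert i (int r - 1))"
        using g unfolding extensions_def by blast
      then show ?thesis using r by (simp add: nat_diff_distrib')
    qed
    have strip_diff: "e = horiz (a - 1) (int r) \<or> e = horiz (a - 1) (int r + 1)"
      if "e \<in> strip a (int r) m" "e \<notin> mid" for e
      using that r unfolding mid_def
      by (auto simp: strip_def vert_in_inner_edges horiz_in_inner_edges)
    let ?ext = "\<lambda>D. extensions g D (edge_range N)"
    let ?\<phi> = "\<lambda>f. of_bool (f (horiz (a - 1) (int r)) = b \<and> f (horiz (a - 1) (int r + 1)) = b) :: complex"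
    have left_mid: "horiz (a - 1) j \<notin> mid" for j
      by (simp add: mid_def horiz_in_inner_edges)
    \<comment> \<open>The two left boundary edges are released to obtain a sum over the whole strip;
      the indicator removes the assignments added by this.\<close>
    have "(\<Sum>f\<in>?ext mid. \<Prod>i\<in>{a..<a + int m}. column_product q s x y (int r) f i) =
        (\<Sum>f\<in>?ext (strip a (int r) m). ?\<phi> f * (\<Prod>i\<in>{a..<a + int m}. column_product q s x y (int r) f i))"
    proof (rule sum.mono_neutral_cong_left)
      show "finite (?ext (strip a (int r) m))" by (intro finite_extensions) auto
      show "?ext mid \<subseteq> ?ext (strip a (int r) m)"
      proof
        fix f assume f: "f \<in> ?ext mid"
        have "f e \<in> edge_range N e" if es: "e \<in> strip a (int r) m" for e
        proof (cases "e \<in> mid")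
          case False
          then have "f e = g e" using f unfolding extensions_def by blast
          then have "f e = b" using strip_diff[OF es False] lr(1,2) by auto
          moreover have "edge_range N e = {..1}" using strip_diff[OF es False] by auto
          ultimately show ?thesis using b by simp
        qed (use f in \<open>simp add: extensions_def\<close>)
        moreover have "f e = g e" if "e \<notin> strip a (int r) m" for e
          using f that unfolding extensions_def mid_def by blast
        ultimately show "f \<in> ?ext (strip a (int r) m)" by (simp add: extensions_def)
      qed
      show "\<forall>f\<in>?ext (strip a (int r) m) - ?ext mid.
          ?\<phi> f * (\<Prod>i\<in>{a..<a + int m}. column_product q s x y (int r) f i) = 0"
      proof
        fix f assume f: "f \<in> ?ext (strip a (int r) m) - ?ext mid"
        have "\<exists>e. e \<notin> mid \<and> f e \<noteq> g e"
        proof (rule ccontr)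
          assume "\<not> ?thesis"
          then have "f \<in> ?ext mid" using f unfolding extensions_def mid_def by blast
          then show False using f by simp
        qed
        then obtain e where e: "e \<notin> mid" "f e \<noteq> g e" by blast
        then have "e \<in> strip a (int r) m" using f unfolding extensions_def by blast
        from strip_diff[OF this e(1)] e(2) lr(1,2) have "?\<phi> f = 0" by auto
        then show "?\<phi> f * (\<Prod>i\<in>{a..<a + int m}. column_product q s x y (int r) f i) = 0"
          by (simp only: mult_zero_left)
      qed
      show "(\<Prod>i\<in>{a..<a + int m}. column_product q s x y (int r) f i) =
          ?\<phi> f * (\<Prod>i\<in>{a..<a + int m}. column_product q s x y (int r) f i)" if f: "f \<in> ?ext mid" for f
      proof -
        have "f (horiz (a - 1) j) = g (horiz (a - 1) j)" for j
          using f left_mid unfolding extensions_def by blast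
        then show ?thesis by (simp add: lr(1,2))
      qed
    qed
    also have "\<dots> = two_rows q s x y (\<lambda>c. g (vert (a + int c) (int r - 1)))
        (\<lambda>c. g (vert (a + int c) (int r + 1))) b m 0 0"
      by (subst sum_strip_eq_two_rows[where g = g and r = "int r"]) (use cap in \<open>simp_all add: lr\<close>)
    finally show ?thesis .
  qed
  have expand: "box_sum q s a m n N f0 w = (\<Sum>g\<in>extensions f0 rest (edge_range N). outer w g *
      two_rows q s (w r) (w (Suc r)) (\<lambda>c. g (vert (a + int c) (int r - 1)))
        (\<lambda>c. g (vert (a + int c) (int r + 1))) b m 0 0)" for w
  proof -
    have "box_sum q s a m n N f0 w = (\<Sum>g\<in>extensions f0 rest (edge_range N).
        \<Sum>f\<in>extensions g mid (edge_range N). outer w f *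
          (\<Prod>i\<in>{a..<a + int m}. column_product q s (w r) (w (Suc r)) (int r) f i))"
      unfolding box_sum_def inner box_weight_split[OF r] outer_def
      by (rule sum_extensions_Un) (use fin disj in auto)
    also have "\<dots> = (\<Sum>g\<in>extensions f0 rest (edge_range N). outer w g *
        (\<Sum>f\<in>extensions g mid (edge_range N).
          \<Prod>i\<in>{a..<a + int m}. column_product q s (w r) (w (Suc r)) (int r) f i))"
      unfolding sum_distrib_left using outer by (intro sum.cong refl) simp
    finally show ?thesis by (simp add: strip_sum)
  qed
  show ?thesis
    unfolding expand outer_swap using two_rows_commute[OF b u, of q "u r"] by simp
qed


section \<open>Adjacent transpositions generate all permutations\<close>

lemma symmetric_if_adjacent_symmetric:
  fixes T :: "(nat \<Rightarrow> 'a) \<Rightarrow> 'b" and Q :: "'a \<Rightarrow> bool"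
  assumes adj: "\<And>u r. \<forall>j\<in>{1..n}. Q (u j) \<Longrightarrow> 1 \<le> r \<Longrightarrow> r < n \<Longrightarrow> T (u \<circ> transpose r (Suc r)) = T u"
    and \<sigma>: "\<sigma> permutes {1..n}" and u: "\<forall>j\<in>{1..n}. Q (u j)"
  shows "T (u \<circ> \<sigma>) = T u"
proof -
  \<comment> \<open>The condition on the variables, later the avoidance of poles, has to survive
    every intermediate permutation.\<close>
  have Q_comp: "\<forall>j\<in>{1..n}. Q ((u \<circ> \<tau>) j)" if "\<forall>j\<in>{1..n}. Q (u j)" "\<tau> permutes {1..n}" for u \<tau>
    using that permutes_in_image[OF that(2)] by auto
  have tr: "T (u \<circ> transpose i j) = T u" if "i < j" "1 \<le> i" "j \<le> n" "\<forall>j\<in>{1..n}. Q (u j)" for i j u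
    using that
  proof (induction j arbitrary: u)
    case (Suc j)
    show ?case
    proof (cases "i = j")
      case True
      show ?thesis unfolding True by (rule adj) (use True Suc.prems in auto)
    next
      case False
      let ?t = "transpose j (Suc j)"
      have t: "?t permutes {1..n}"
        using Suc.prems False by (intro permutes_swap_id) auto
      \<comment> \<open>Conjugation by an adjacent transposition shortens the distance between the
        exchanged positions.\<close>
      have "transpose i (Suc j) = ?t \<circ> transpose i j \<circ> ?t"
        using Suc.prems False by (auto simp: fun_eq_iff transpose_def)
      then have "T (u \<circ> transpose i (Suc j)) = T ((u \<circ> ?t \<circ> transpose i j) \<circ> ?t)"
        by (simp add: comp_assoc)
      also have "\<dots> = T (u \<circ> ?t \<circ> transpose i j)"
      proof (rule adj)
        have "transpose i j permutes {1..n}" using Suc.prems False by (intro permutes_swap_id) auto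
        then show "\<forall>k\<in>{1..n}. Q ((u \<circ> ?t \<circ> transpose i j) k)"
          by (intro Q_comp Suc.prems(4) t)
      qed (use Suc.prems False in auto)
      also have "\<dots> = T (u \<circ> ?t)"
        using Suc.prems False by (intro Suc.IH Q_comp Suc.prems(4) t) auto
      also have "\<dots> = T u" by (rule adj) (use Suc.prems False in auto)
      finally show ?thesis .
    qed
  qed simp
  have "finite {1..n}" by simp
  from this \<sigma> show ?thesis
  proof (induction rule: permutes_rev_induct)
    case id
    then show ?case by simp
  next
    case (swap a b p)
    have "T (u \<circ> (p \<circ> transpose a b)) = T (u \<circ> p \<circ> transpose a b)" by (simp add: comp_assoc)
    also have "\<dots> = T (u \<circ> p)"
      using swap.hyps(1-3) Q_comp[OF u swap.hyps(4)] tr[of a b "u \<circ> p"] tr[of b a "u \<circ> p"]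
      by (cases a b rule: linorder_cases) (auto simp: transpose_commute)
    also have "\<dots> = T u" by (rule swap.IH)
    finally show ?case .
  qed
qed

subsection \<open>Path sums as partition functions\<close>

lemma count_image_fst:
  assumes "\<forall>e\<in>#X. up_right_step (fst e) (snd e)"
  shows "count (image_mset fst X) (i, j) = count X (vert i j) + count X (horiz i j)"
  using assms
proof (induction X)
  case (add e X)
  then obtain i' j' where "e = vert i' j' \<or> e = horiz i' j'"
    by (auto simp: up_right_step_iff)
  with add show ?case by auto
qed simp

lemma count_image_snd:
  assumes "\<forall>e\<in>#X. up_right_step (fst e) (snd e)"
  shows "count (image_mset snd X) (i, j) = count X (vert i (j - 1)) + count X (horiz (i - 1) j)"
  using assms
proof (induction X)
  case (add e X)
  then obtain i' j' where "e = vert i' j' \<or> e = horiz i' j'"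
    by (auto simp: up_right_step_iff)
  with add show ?case by auto
qed simp

text \<open>Multiplicities of flows and admissible edge functions are compared only where the weight
  is nonzero; there the two sets coincide, and all other terms contribute nothing to either
  sum.\<close>

lemma path_sum_eq_box_sum:
  assumes S: "\<And>e. e \<in># S \<Longrightarrow> up_right_step (fst e) (snd e) \<and> fst e \<notin> box a m n \<and> snd e \<in> box a m n"
    and E: "\<And>e. e \<in># E \<Longrightarrow> up_right_step (fst e) (snd e) \<and> fst e \<in> box a m n \<and> snd e \<notin> box a m n"
    and bottom: "\<And>i. i \<in> {a..<a + int m} \<Longrightarrow> count (S + E) (vert i 0) \<le> N"
    and u: "\<forall>j\<in>{1..n}. 1 - s * u j \<noteq> 0"
  shows "path_sum q s S E u = box_sum q s a m n N (count (S + E)) u"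
proof -
  let ?B = "box a m n" and ?I = "inner_edges a m n" and ?f0 = "count (S + E)"
  let ?W = "box_weight q s a m n u"
  have S0: "count S e = 0" if "fst e \<in> ?B \<or> snd e \<notin> ?B" for e
    using S[of e] that by (auto simp: not_in_iff[symmetric])
  have E0: "count E e = 0" if "fst e \<notin> ?B \<or> snd e \<in> ?B" for e
    using E[of e] that by (auto simp: not_in_iff[symmetric])
  have flowD: "\<forall>e\<in>#X. up_right_step (fst e) (snd e)" "count S e \<le> count X e" "count E e \<le> count X e"
    "image_mset fst (X - S) = image_mset snd (X - E)" if "X \<in> flows S E" for X e
    using that by (auto simp: flows_def mset_subset_eq_count)
  \<comment> \<open>The second and the second to last vertex of each path lie in the box, and an
    up-right path stays in the rectangle spanned by its ends.\<close>
  have interior: "fst ` set_mset (X - S) \<subseteq> ?B" if X: "X \<in> flows S E" for X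
  proof -
    obtain C where C: "C \<in> path_collections S E" "edges_of C = X"
      using flow_decomposition[OF X] by blast
    have "v \<in> ?B" if p: "p \<in># C" and v: "v \<in> set p - {hd p, last p}" for p v
    proof -
      have "up_right_path p" using C p by (auto simp: path_collections_def)
      then have len: "2 \<le> length p" and suc: "successively up_right_step p"
        by (auto simp: up_right_path_def)
      have "hd (path_edges p) \<in># S" "last (path_edges p) \<in># E"
        using C p by (auto simp: path_collections_def)
      then have ends: "hd (tl p) \<in> ?B" "last (butlast p) \<in> ?B"
        using S E snd_hd_path_edges[OF len] fst_last_path_edges[OF len] by metis+
      obtain x p' y where pxy: "p = x # p' @ [y]"
        using len by (cases p; cases "tl p" rule: rev_cases) auto
      have "p' \<noteq> []" "v \<in> set p'" using v pxy by auto
      moreover have "successively up_right_step ([x] @ p' @ [y])"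
        using suc pxy by simp
      then have "successively up_right_step p'"
        by (simp only: successively_append_iff)
      moreover have "hd p' \<in> ?B" "last p' \<in> ?B"
        using ends pxy \<open>p' \<noteq> []\<close> by (auto simp: butlast_append)
      ultimately show ?thesis
        using up_right_path_bounds[of p'] by (fastforce simp: box_def)
    qed
    then show ?thesis
      using edges_of_in_flows(2)[OF C(1)] C(2) unfolding interior_vertices_def by blast
  qed
  have out_edge: "count X e = count S e" if "X \<in> flows S E" "fst e \<notin> fst ` set_mset (X - S)" for X e
  proof -
    have "e \<notin># X - S" using that by auto
    then show ?thesis using flowD(2)[OF that(1), of e] by (simp add: in_diff_count)
  qed
  have in_edge: "count X e = count E e" if "X \<in> flows S E" "snd e \<notin> fst ` set_mset (X - S)" for X e
  proof -
    have "snd e \<notin># image_mset fst (X - S)" using that(2) by simp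
    then have "e \<notin># X - E" unfolding flowD(4)[OF that(1)] by auto
    then show ?thesis using flowD(3)[OF that(1), of e] by (simp add: in_diff_count)
  qed
  \<comment> \<open>The product may be extended to the whole box: a vertex that no path visits has
    weight \<open>(1 - s * u) / (1 - s * u) = 1\<close> away from the pole.\<close>
  have weight: "(\<Prod>v\<in>fst ` set_mset (X - S). vertex_weight q s (u (nat (snd v))) (numbers_at (count X) v)) =
      ?W (count X)" if X: "X \<in> flows S E" for X
    unfolding box_weight_def
  proof (rule prod.mono_neutral_left[OF finite_box interior[OF X]], rule ballI)
    fix v assume v: "v \<in> ?B - fst ` set_mset (X - S)"
    obtain i j where ij: "v = (i, j)" by (cases v)
    have "count X e = 0" if "fst e = v" for e
      using out_edge[OF X, of e] S0[of e] that v by simp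
    moreover have "count X e = 0" if "snd e = v" for e
      using in_edge[OF X, of e] E0[of e] that v by simp
    ultimately have "numbers_at (count X) v = (0, 0, 0, 0)"
      by (simp add: ij numbers_at_eq)
    moreover have "nat (snd v) \<in> {1..n}"
      using v by (auto simp: box_def)
    then have "1 - s * u (nat (snd v)) \<noteq> 0"
      using u by blast
    ultimately show "vertex_weight q s (u (nat (snd v))) (numbers_at (count X) v) = 1"
      by (simp add: vertex_weight.simps)
  qed
  have nonzero: "f (vert i (j - 1)) + f (horiz (i - 1) j) = f (vert i j) + f (horiz i j)"
      "f (horiz (i - 1) j) \<le> 1" "f (horiz i j) \<le> 1"
    if "?W f \<noteq> 0" "(i, j) \<in> ?B" for f i j
  proof -
    have "vertex_weight q s (u (nat j)) (numbers_at f (i, j)) \<noteq> 0"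
      using that unfolding box_weight_def by fastforce
    from vertex_weight_nonzero[OF this[unfolded numbers_at_eq]]
    show "f (vert i (j - 1)) + f (horiz (i - 1) j) = f (vert i j) + f (horiz i j)"
      "f (horiz (i - 1) j) \<le> 1" "f (horiz i j) \<le> 1" by auto
  qed
  have outside: "count X e = ?f0 e" if X: "X \<in> flows S E" and e: "e \<notin> ?I" for X e
  proof (cases "up_right_step (fst e) (snd e)")
    case False
    then have "e \<notin># X" "e \<notin># S" "e \<notin># E" using flowD(1)[OF X] S E by blast+
    then show ?thesis by (simp add: not_in_iff)
  next
    case True
    then have "fst e \<notin> ?B \<or> snd e \<notin> ?B" using e by (simp add: inner_edges_def)
    then show ?thesis
    proof
      assume e: "fst e \<notin> ?B"
      then have "fst e \<notin> fst ` set_mset (X - S)" using interior[OF X] by blast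
      then show ?thesis using out_edge[OF X] E0[of e] e by simp
    next
      assume e: "snd e \<notin> ?B"
      then have "snd e \<notin> fst ` set_mset (X - S)" using interior[OF X] by blast
      then show ?thesis using in_edge[OF X] S0[of e] e by simp
    qed
  qed
  have flow_in: "count X \<in> extensions ?f0 ?I (edge_range N)" if X: "X \<in> flows S E" and W: "?W (count X) \<noteq> 0" for X
  proof -
    \<comment> \<open>Going up a column, each vertex of nonzero weight receives at most one path
      from the West, so the vertical edge number grows by at most one per row.\<close>
    have height: "count X (vert i (int j)) \<le> N + j" if "i \<in> {a..<a + int m}" "j \<le> n" for i j
      using that(2)
    proof (induction j)
      case 0
      have "count X (vert i 0) = ?f0 (vert i 0)"
        using outside[OF X] by (simp add: vert_in_inner_edges)
      then show ?case using bottom[OF that(1)] by simp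
    next
      case (Suc j)
      then have "(i, int (Suc j)) \<in> ?B" using that(1) by (auto simp: box_def)
      from nonzero[OF W this] Suc show ?case by simp
    qed
    have "count X e \<in> edge_range N e" if "e \<in> ?I" for e
    proof -
      have "up_right_step (fst e) (snd e)" using that by (simp add: inner_edges_def)
      then consider i j where "e = vert i j" | i j where "e = horiz i j"
        unfolding up_right_step_iff by blast
      then show ?thesis
      proof cases
        case (1 i j)
        then show ?thesis using height[of i "nat j"] that by (simp add: vert_in_inner_edges nat_le_iff)
      next
        case (2 i j)
        then have "(i, j) \<in> ?B" using that by (simp add: inner_edges_def)
        from nonzero(3)[OF W this] show ?thesis using 2 by simp
      qed
    qed
    with outside[OF X] show ?thesis unfolding extensions_def by blast
  qed
  \<comment> \<open>Such an \<open>f\<close> has finite support and is thus the multiplicity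
    function of a multiset, which has to be shown to be a flow.\<close>
  have in_flow: "f \<in> count ` flows S E" if f: "f \<in> extensions ?f0 ?I (edge_range N)" and W: "?W f \<noteq> 0" for f
  proof -
    have f0: "f e = ?f0 e" if "e \<notin> ?I" for e
      using f that unfolding extensions_def by blast
    have "{e. f e > 0} \<subseteq> ?I \<union> set_mset (S + E)"
    proof
      fix e assume "e \<in> {e. f e > 0}"
      then show "e \<in> ?I \<union> set_mset (S + E)"
        using f0[of e] by (cases "e \<in> ?I") (auto simp flip: count_greater_zero_iff)
    qed
    then have fin: "finite {e. f e > 0}" by (rule finite_subset) simp
    define X where "X = Abs_multiset f"
    have cX: "count X = f" unfolding X_def using fin by (rule count_Abs_multiset)
    have step: "\<forall>e\<in>#X. up_right_step (fst e) (snd e)"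
    proof
      fix e assume "e \<in># X"
      then have "e \<in> ?I \<union> set_mset (S + E)"
        using \<open>_ \<subseteq> ?I \<union> _\<close> by (auto simp: cX simp flip: count_greater_zero_iff)
      then show "up_right_step (fst e) (snd e)" using S[of e] E[of e] by (auto simp: inner_edges_def)
    qed
    have le: "count S e \<le> count X e" "count E e \<le> count X e" for e
      using f0[of e] S0[of e] E0[of e] unfolding cX by (cases "e \<in> ?I"; simp add: inner_edges_def)+
    have "image_mset fst (X - S) = image_mset snd (X - E)"
    proof (rule multiset_eqI)
      fix v :: vertex
      obtain i j where ij: "v = (i, j)" by (cases v)
      have diff_steps: "\<forall>e\<in>#X - S. up_right_step (fst e) (snd e)" "\<forall>e\<in>#X - E. up_right_step (fst e) (snd e)"
        using step by (auto dest: in_diffD)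
      have lhs: "count (image_mset fst (X - S)) v =
          (f (vert i j) - count S (vert i j)) + (f (horiz i j) - count S (horiz i j))"
        unfolding ij count_image_fst[OF diff_steps(1)] by (simp add: cX)
      have rhs: "count (image_mset snd (X - E)) v =
          (f (vert i (j - 1)) - count E (vert i (j - 1))) + (f (horiz (i - 1) j) - count E (horiz (i - 1) j))"
        unfolding ij count_image_snd[OF diff_steps(2)] by (simp add: cX)
      show "count (image_mset fst (X - S)) v = count (image_mset snd (X - E)) v"
      \<comment> \<open>Inside the box, nonzero weight forces conservation. Outside it, outgoing
        edges have the multiplicity given by \<open>S\<close> and incoming ones that given by
        \<open>E\<close>, so both sides are \<open>0\<close>.\<close>
      proof (cases "v \<in> ?B")
        case True
        then have "(i, j) \<in> ?B" by (simp add: ij)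
        with nonzero(1)[OF W this] show ?thesis unfolding lhs rhs by (simp add: S0 E0)
      next
        case False
        then have v: "(i, j) \<notin> ?B" by (simp add: ij)
        then have "vert i j \<notin> ?I" "horiz i j \<notin> ?I" "vert i (j - 1) \<notin> ?I" "horiz (i - 1) j \<notin> ?I"
          by (simp_all add: inner_edges_def)
        with v show ?thesis unfolding lhs rhs by (simp add: f0 S0 E0)
      qed
    qed
    then have "X \<in> flows S E"
      using step le by (simp add: flows_def mset_subset_eqI)
    with cX show ?thesis by blast
  qed
  have "path_sum q s S E u = (\<Sum>X\<in>flows S E. ?W (count X))"
    unfolding path_sum_eq_flows using weight by (intro sum.cong refl) auto
  also have "\<dots> = (\<Sum>f\<in>count ` flows S E. ?W f)"
    by (simp add: sum.reindex inj_on_def count_inject)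
  also have "\<dots> = box_sum q s a m n N ?f0 u"
    unfolding box_sum_def
    by (rule sum.mono_neutral_cong)
       (use flow_in in_flow in \<open>auto simp: finite_flows finite_extensions\<close>)
  finally show ?thesis .
qed

lemma path_sum_symmetric:
  assumes S: "\<And>e. e \<in># S \<Longrightarrow> up_right_step (fst e) (snd e) \<and> fst e \<notin> box a m n \<and> snd e \<in> box a m n"
    and E: "\<And>e. e \<in># E \<Longrightarrow> up_right_step (fst e) (snd e) \<and> fst e \<in> box a m n \<and> snd e \<notin> box a m n"
    and b: "b \<le> 1"
    and left: "\<And>j. j \<in> {1..int n} \<Longrightarrow> count (S + E) (horiz (a - 1) j) = b"
    and right: "\<And>j. j \<in> {1..int n} \<Longrightarrow> count (S + E) (horiz (a + int m - 1) j) = 0"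
    and u: "\<forall>j\<in>{1..n}. 1 - s * u j \<noteq> 0" and \<sigma>: "\<sigma> permutes {1..n}"
  shows "path_sum q s S E (u \<circ> \<sigma>) = path_sum q s S E u"
proof (rule symmetric_if_adjacent_symmetric[where n = n and Q = "\<lambda>x. 1 - s * x \<noteq> 0"])
  fix u :: "nat \<Rightarrow> complex" and r
  assume u: "\<forall>j\<in>{1..n}. 1 - s * u j \<noteq> 0" and r: "1 \<le> r" "r < n"
  \<comment> \<open>The total number of prescribed edges bounds the multiplicity of each, in
    particular below the first row.\<close>
  define N where "N = size (S + E)"
  have N: "count (S + E) e \<le> N" for e unfolding N_def by (rule count_le_size)
  have u': "\<forall>j\<in>{1..n}. 1 - s * (u \<circ> transpose r (Suc r)) j \<noteq> 0"
    using u r by (auto simp: transpose_def)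
  have "box_sum q s a m n N (count (S + E)) (u \<circ> transpose r (Suc r)) = box_sum q s a m n N (count (S + E)) u"
    by (rule box_sum_swap[OF r _ b left right N]) (use u r in auto)
  then show "path_sum q s S E (u \<circ> transpose r (Suc r)) = path_sum q s S E u"
    by (simp only: path_sum_eq_box_sum[OF S E N u] path_sum_eq_box_sum[OF S E N u'])
qed (use u \<sigma> in auto)

section \<open>Boundary edges of \<open>F\<close> and \<open>G\<close>\<close>

lemma set_vertical_edges: "e \<in># vertical_edges lam j \<longleftrightarrow> (\<exists>i\<in>set lam. e = vert i j)"
  by (auto simp: vertical_edges_def vert_def)

lemma count_vertical_edges_horiz [simp]: "count (vertical_edges lam j') (horiz i j) = 0"
  by (auto simp: set_vertical_edges simp flip: not_in_iff)

lemma left_edges_eq: "left_edges n = image_mset (\<lambda>j. horiz (- 1) (int j)) (mset_set {1..n})"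
  by (simp add: left_edges_def horiz_def)

lemma count_left_edges:
  "count (left_edges n) (horiz i j) = (if i = - 1 \<and> j \<in> {1..int n} then 1 else 0)"
proof -
  have "left_edges n = mset_set ((\<lambda>j. horiz (- 1) (int j)) ` {1..n})"
    unfolding left_edges_eq by (intro image_mset_mset_set inj_onI) simp
  moreover have "horiz i j \<in> (\<lambda>j. horiz (- 1) (int j)) ` {1..n} \<longleftrightarrow> i = - 1 \<and> j \<in> {1..int n}"
    by (auto intro!: image_eqI[of _ _ "nat j"])
  ultimately show ?thesis by (simp add: count_mset_set')
qed

lemma bounded_columns:
  fixes A :: "int set"
  assumes "finite A"
  shows "\<exists>a m. A \<subseteq> {a..<a + int m}"
proof (cases "A = {}")
  case False
  have "A \<subseteq> {Min A..<Min A + int (nat (Max A - Min A + 1))}"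
  proof
    fix x assume "x \<in> A"
    then have "Min A \<le> x" "x \<le> Max A" using assms by auto
    then show "x \<in> {Min A..<Min A + int (nat (Max A - Min A + 1))}" by simp
  qed
  then show ?thesis by blast
qed auto

theorem theorem3p5:
  fixes q s :: complex
  shows "(\<forall>L M :: nat. \<forall>lam mu :: int list. M \<le> L \<longrightarrow> lam \<in> Sign_plus L \<longrightarrow> mu \<in> Sign_plus M \<longrightarrow>
           (\<forall>(u :: nat \<Rightarrow> complex) \<sigma>. (\<forall>j\<in>{1..L - M}. 1 - s * u j \<noteq> 0) \<longrightarrow> \<sigma> permutes {1..L - M} \<longrightarrow>
             F q s lam mu (u \<circ> \<sigma>) = F q s lam mu u)) \<and>
         (\<forall>L k :: nat. \<forall>lam nu :: int list. lam \<in> Sign L \<longrightarrow> nu \<in> Sign L \<longrightarrow>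
           (\<forall>(u :: nat \<Rightarrow> complex) \<sigma>. (\<forall>j\<in>{1..k}. 1 - s * u j \<noteq> 0) \<longrightarrow> \<sigma> permutes {1..k} \<longrightarrow>
             G q s k lam nu (u \<circ> \<sigma>) = G q s k lam nu u))"
proof (intro conjI allI impI)
  fix L M :: nat and lam mu :: "int list" and u :: "nat \<Rightarrow> complex" and \<sigma> :: "nat \<Rightarrow> nat"
  assume lam: "lam \<in> Sign_plus L" and mu: "mu \<in> Sign_plus M"
    and u: "\<forall>j\<in>{1..L - M}. 1 - s * u j \<noteq> 0" and \<sigma>: "\<sigma> permutes {1..L - M}"
  define n where "n = L - M"
  have F: "F q s lam mu w = path_sum q s (vertical_edges mu 0 + left_edges n) (vertical_edges lam (int n)) w" for w
    using lam mu by (simp add: F_def n_def Sign_plus_def Sign_def Let_def)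
  show "F q s lam mu (u \<circ> \<sigma>) = F q s lam mu u"
  \<comment> \<open>A box without rows has no vertices for the prescribed edges to enter, but then
    the only permutation is the identity.\<close>
  proof (cases "n = 0")
    case True
    then have "\<sigma> = id" using \<sigma> by (simp add: n_def)
    then show ?thesis by simp
  next
    case False
    obtain a' m' where "set lam \<union> set mu \<subseteq> {a'..<a' + int m'}"
      using bounded_columns[of "set lam \<union> set mu"] by auto
    \<comment> \<open>The box begins at column \<open>0\<close>, where the left edges end;
      nonnegativity of the parts keeps all vertical edges to the right of it. The \<open>Suc\<close>
      ensures that column \<open>0\<close> belongs to the box.\<close>
    then have cols: "i \<in> {0..<int (Suc (nat (a' + int m')))}" if "i \<in> set lam \<union> set mu" for i
      using that lam mu by (force simp: Sign_plus_def)
    let ?m = "Suc (nat (a' + int m'))"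
    show ?thesis unfolding F
    proof (rule path_sum_symmetric[where a = 0 and m = ?m and n = n and b = 1])
      show "up_right_step (fst e) (snd e) \<and> fst e \<notin> box 0 ?m n \<and> snd e \<in> box 0 ?m n"
        if "e \<in># vertical_edges mu 0 + left_edges n" for e
        using that cols False
        by (auto simp: up_right_step_iff box_def set_vertical_edges left_edges_eq)
      show "up_right_step (fst e) (snd e) \<and> fst e \<in> box 0 ?m n \<and> snd e \<notin> box 0 ?m n"
        if "e \<in># vertical_edges lam (int n)" for e
        using that cols False by (auto simp: up_right_step_iff box_def set_vertical_edges)
    qed (use u \<sigma> in \<open>auto simp: count_left_edges n_def\<close>)
  qed
next
  fix L k :: nat and lam nu :: "int list" and u :: "nat \<Rightarrow> complex" and \<sigma> :: "nat \<Rightarrow> nat"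
  assume u: "\<forall>j\<in>{1..k}. 1 - s * u j \<noteq> 0" and \<sigma>: "\<sigma> permutes {1..k}"
  show "G q s k lam nu (u \<circ> \<sigma>) = G q s k lam nu u"
  proof (cases "k = 0")
    case True
    then have "\<sigma> = id" using \<sigma> by simp
    then show ?thesis by simp
  next
    case False
    \<comment> \<open>Parts may be negative here, so the box starts at an arbitrary column; no path
      enters from the left, hence \<open>b = 0\<close> below.\<close>
    obtain a m where cols: "set lam \<union> set nu \<subseteq> {a..<a + int m}"
      using bounded_columns[of "set lam \<union> set nu"] by auto
    show ?thesis unfolding G_def
    proof (rule path_sum_symmetric[where a = a and m = m and n = k and b = 0])
      show "up_right_step (fst e) (snd e) \<and> fst e \<notin> box a m k \<and> snd e \<in> box a m k"
        if "e \<in># vertical_edges nu 0" for e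
        using that cols False by (auto simp: up_right_step_iff box_def set_vertical_edges)
      show "up_right_step (fst e) (snd e) \<and> fst e \<in> box a m k \<and> snd e \<notin> box a m k"
        if "e \<in># vertical_edges lam (int k)" for e
        using that cols False by (auto simp: up_right_step_iff box_def set_vertical_edges)
    qed (use u \<sigma> in auto)
  qed
qed

end
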